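(* Let $I=(P,F,G,B)$ be an instance of Seat Arrangement with symmetric preferences and B-utility. Then an exchange-stable arrangement always exists, and there is a polynomial-time algorithm that, given such an instance, outputs an exchange-stable arrangement.
   Context: An instance $I=(P,F,G,U)$ of Seat Arrangement consists of a finite set $P$ of agents; for each $p\in P$ a valuation function $f_p:P\setminus\{p\}\to\mathbb{R}$; an undirected simple graph $G$ (the seat graph) with $|V(G)|=|P|$; and a utility type $U\in\{B,S,W\}$. An arrangement is a bijection $\sigma:P\to V(G)$. Writing $N(\sigma(p))$ for the set of neighbours of $\sigma(p)$ in $G$, the utility of $p$ under $\sigma$ for B-utility is $u_\sigma(p)=\max_{v\in N(\sigma(p))} f_p(\sigma^{-1}(v))$, and $u_\sigma(p)=0$ if $\sigma(p)$ has no neighbours. For distinct $p,q\in P$, $\sigma^{p\leftrightarrow q}$ denotes the arrangement equal to $\sigma$ except that $p$ is seated at $\sigma(q)$ and $q$ at $\sigma(p)$. Agent $p$ envies $q$ under $\sigma$ if $u_\sigma(p)<u_{\sigma^{p\leftrightarrow q}}(p)$. A pair $\{p,q\}$ is exchange-blocking if $p$ envies $q$ and $q$ envies $p$; $\sigma$ is exchange-stable if no exchange-blocking pair exists. Preferences are symmetric if $f_p(q)=f_q(p)$ for all distinct $p,q\in P$. *)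

theory Defs
  imports Complex_Main "HOL-Library.Log_Nat" "HOL-Computational_Algebra.Polynomial"
begin

section \<open>Seat Arrangement with B-utility\<close>

definition simple_graph :: "'v set \<Rightarrow> 'v set set \<Rightarrow> bool" where
  "simple_graph V E \<longleftrightarrow> finite V \<and> E \<subseteq> {{u, v} | u v. u \<in> V \<and> v \<in> V \<and> u \<noteq> v}"

definition neighbours :: "'v set set \<Rightarrow> 'v \<Rightarrow> 'v set" where
  "neighbours E v = {w. {v, w} \<in> E}"

definition sa_instance :: "'p set \<Rightarrow> 'v set \<Rightarrow> 'v set set \<Rightarrow> bool" where
  "sa_instance P V E \<longleftrightarrow> finite P \<and> simple_graph V E \<and> card V = card P"

text \<open>
  A valuation profile is a function \<open>f\<close> with \<open>f p q\<close> the value of \<open>q\<close> to \<open>p\<close>. Its values on the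
  diagonal and outside of \<open>P\<close> are irrelevant to all notions below.
\<close>

definition symmetric_preferences :: "'p set \<Rightarrow> ('p \<Rightarrow> 'p \<Rightarrow> real) \<Rightarrow> bool" where
  "symmetric_preferences P f \<longleftrightarrow> (\<forall>p\<in>P. \<forall>q\<in>P. p \<noteq> q \<longrightarrow> f p q = f q p)"

definition arrangement :: "'p set \<Rightarrow> 'v set \<Rightarrow> ('p \<Rightarrow> 'v) \<Rightarrow> bool" where
  "arrangement P V \<sigma> \<longleftrightarrow> bij_betw \<sigma> P V"

definition b_utility ::
  "'p set \<Rightarrow> 'v set set \<Rightarrow> ('p \<Rightarrow> 'p \<Rightarrow> real) \<Rightarrow> ('p \<Rightarrow> 'v) \<Rightarrow> 'p \<Rightarrow> real" where
  "b_utility P E f \<sigma> p =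
    (if neighbours E (\<sigma> p) = {} then 0
     else Max ((\<lambda>v. f p (the_inv_into P \<sigma> v)) ` neighbours E (\<sigma> p)))"

definition swap_seats :: "('p \<Rightarrow> 'v) \<Rightarrow> 'p \<Rightarrow> 'p \<Rightarrow> ('p \<Rightarrow> 'v)" where
  "swap_seats \<sigma> p q = \<sigma>(p := \<sigma> q, q := \<sigma> p)"

definition envies ::
  "'p set \<Rightarrow> 'v set set \<Rightarrow> ('p \<Rightarrow> 'p \<Rightarrow> real) \<Rightarrow> ('p \<Rightarrow> 'v) \<Rightarrow> 'p \<Rightarrow> 'p \<Rightarrow> bool" where
  "envies P E f \<sigma> p q \<longleftrightarrow> b_utility P E f \<sigma> p < b_utility P E f (swap_seats \<sigma> p q) p"

definition exchange_blocking ::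
  "'p set \<Rightarrow> 'v set set \<Rightarrow> ('p \<Rightarrow> 'p \<Rightarrow> real) \<Rightarrow> ('p \<Rightarrow> 'v) \<Rightarrow> 'p \<Rightarrow> 'p \<Rightarrow> bool" where
  "exchange_blocking P E f \<sigma> p q \<longleftrightarrow>
    p \<in> P \<and> q \<in> P \<and> p \<noteq> q \<and> envies P E f \<sigma> p q \<and> envies P E f \<sigma> q p"

definition exchange_stable ::
  "'p set \<Rightarrow> 'v set set \<Rightarrow> ('p \<Rightarrow> 'p \<Rightarrow> real) \<Rightarrow> ('p \<Rightarrow> 'v) \<Rightarrow> bool" where
  "exchange_stable P E f \<sigma> \<longleftrightarrow> (\<nexists>p q. exchange_blocking P E f \<sigma> p q)"

section \<open>Random access programs over an ordered field\<close>

text \<open>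
  Polynomial time is measured on while-programs over a random access memory. The memory has
  finitely many named banks of natural numbers and finitely many named banks of elements of an
  ordered field (those whose names occur in the program). Programs contain no field constants, so
  the same program can be run over the reals and over the rationals.
\<close>

datatype nexp =
    NConst nat
  | NRead string nexp
  | NAdd nexp nexp
  | NSub nexp nexp
  | NMul nexp nexp

datatype fexp =
    FOfNat nexp
  | FRead string nexp
  | FAdd fexp fexp
  | FSub fexp fexp
  | FMul fexp fexp
  | FDiv fexp fexp

datatype bexp =
    NLess nexp nexp
  | FLess fexp fexp
  | BNot bexp
  | BAnd bexp bexp

datatype com =
    Skip
  | NWrite string nexp nexp
  | FWrite string nexp fexp
  | Seq com com
  | Cond bexp com com
  | While bexp com

type_synonym 'a memory = "(string \<Rightarrow> nat \<Rightarrow> nat) \<times> (string \<Rightarrow> nat \<Rightarrow> 'a)"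

primrec nval :: "nexp \<Rightarrow> 'a memory \<Rightarrow> nat" where
  "nval (NConst k) s = k"
| "nval (NRead x e) s = fst s x (nval e s)"
| "nval (NAdd d e) s = nval d s + nval e s"
| "nval (NSub d e) s = nval d s - nval e s"
| "nval (NMul d e) s = nval d s * nval e s"

primrec fval :: "fexp \<Rightarrow> 'a::linordered_field memory \<Rightarrow> 'a" where
  "fval (FOfNat e) s = of_nat (nval e s)"
| "fval (FRead x e) s = snd s x (nval e s)"
| "fval (FAdd d e) s = fval d s + fval e s"
| "fval (FSub d e) s = fval d s - fval e s"
| "fval (FMul d e) s = fval d s * fval e s"
| "fval (FDiv d e) s = fval d s / fval e s"

primrec bval :: "bexp \<Rightarrow> 'a::linordered_field memory \<Rightarrow> bool" where
  "bval (NLess d e) s \<longleftrightarrow> nval d s < nval e s"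
| "bval (FLess d e) s \<longleftrightarrow> fval d s < fval e s"
| "bval (BNot b) s \<longleftrightarrow> \<not> bval b s"
| "bval (BAnd b c) s \<longleftrightarrow> bval b s \<and> bval c s"

text \<open>
  Natural numbers, including addresses, are charged logarithmically: every evaluated
  subexpression costs the binary length of its value. (So multiplication cannot be used to build
  exponentially long numbers in polynomial time.) Field elements are charged by a weight \<open>w\<close>:
  the constant weight 1 gives the real random access machine, the weight \<open>rat_bits\<close> below gives
  bit complexity.
\<close>

definition bits :: "int \<Rightarrow> nat" where
  "bits a = Suc (nat (bitlen \<bar>a\<bar>))"

definition rat_bits :: "rat \<Rightarrow> nat" where
  "rat_bits r = bits (fst (quotient_of r)) + bits (snd (quotient_of r))"

primrec ncost :: "nexp \<Rightarrow> 'a memory \<Rightarrow> nat" where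
  "ncost (NConst k) s = bits (int k)"
| "ncost (NRead x e) s = ncost e s + bits (int (nval (NRead x e) s))"
| "ncost (NAdd d e) s = ncost d s + ncost e s + bits (int (nval (NAdd d e) s))"
| "ncost (NSub d e) s = ncost d s + ncost e s + bits (int (nval (NSub d e) s))"
| "ncost (NMul d e) s = ncost d s + ncost e s + bits (int (nval (NMul d e) s))"

primrec fcost :: "('a::linordered_field \<Rightarrow> nat) \<Rightarrow> fexp \<Rightarrow> 'a memory \<Rightarrow> nat" where
  "fcost w (FOfNat e) s = ncost e s + w (fval (FOfNat e) s)"
| "fcost w (FRead x e) s = ncost e s + w (fval (FRead x e) s)"
| "fcost w (FAdd d e) s = fcost w d s + fcost w e s + w (fval (FAdd d e) s)"
| "fcost w (FSub d e) s = fcost w d s + fcost w e s + w (fval (FSub d e) s)"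
| "fcost w (FMul d e) s = fcost w d s + fcost w e s + w (fval (FMul d e) s)"
| "fcost w (FDiv d e) s = fcost w d s + fcost w e s + w (fval (FDiv d e) s)"

primrec bcost :: "('a::linordered_field \<Rightarrow> nat) \<Rightarrow> bexp \<Rightarrow> 'a memory \<Rightarrow> nat" where
  "bcost w (NLess d e) s = ncost d s + ncost e s + 1"
| "bcost w (FLess d e) s = fcost w d s + fcost w e s + 1"
| "bcost w (BNot b) s = bcost w b s + 1"
| "bcost w (BAnd b c) s = bcost w b s + bcost w c s + 1"

definition nwrite :: "string \<Rightarrow> nat \<Rightarrow> nat \<Rightarrow> 'a memory \<Rightarrow> 'a memory" where
  "nwrite x i k s = ((fst s)(x := (fst s x)(i := k)), snd s)"

definition fwrite :: "string \<Rightarrow> nat \<Rightarrow> 'a \<Rightarrow> 'a memory \<Rightarrow> 'a memory" where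
  "fwrite x i a s = (fst s, (snd s)(x := (snd s x)(i := a)))"

text \<open>\<open>exec w c s t s'\<close>: started in \<open>s\<close>, the program \<open>c\<close> halts in \<open>s'\<close> with total cost \<open>t\<close>.\<close>

inductive exec ::
  "('a::linordered_field \<Rightarrow> nat) \<Rightarrow> com \<Rightarrow> 'a memory \<Rightarrow> nat \<Rightarrow> 'a memory \<Rightarrow> bool"
  for w where
  Skip: "exec w Skip s 1 s"
| NWrite: "exec w (NWrite x d e) s (ncost d s + ncost e s + 1) (nwrite x (nval d s) (nval e s) s)"
| FWrite: "exec w (FWrite x d e) s (ncost d s + fcost w e s + 1) (fwrite x (nval d s) (fval e s) s)"
| Seq: "exec w (Seq c d) s (t + u) s''"
    if "exec w c s t s'" and "exec w d s' u s''"
| CondTrue: "exec w (Cond b c d) s (bcost w b s + t) s'"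
    if "bval b s" and "exec w c s t s'"
| CondFalse: "exec w (Cond b c d) s (bcost w b s + t) s'"
    if "\<not> bval b s" and "exec w d s t s'"
| WhileFalse: "exec w (While b c) s (bcost w b s) s"
    if "\<not> bval b s"
| WhileTrue: "exec w (While b c) s (bcost w b s + t + u) s''"
    if "bval b s" and "exec w c s t s'" and "exec w (While b c) s' u s''"

inductive_cases exec_SkipE: "exec w Skip s t s'"
inductive_cases exec_NWriteE: "exec w (NWrite x d e) s t s'"
inductive_cases exec_FWriteE: "exec w (FWrite x d e) s t s'"
inductive_cases exec_SeqE: "exec w (Seq c d) s t s'"
inductive_cases exec_CondE: "exec w (Cond b c d) s t s'"
inductive_cases exec_WhileE: "exec w (While b c) s t s'"

lemma exec_deterministic:
  "exec w c s t s' \<Longrightarrow> exec w c s u s'' \<Longrightarrow> u = t \<and> s'' = s'"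
proof (induction arbitrary: u s'' rule: exec.induct)
  case (Skip s) then show ?case by (auto elim: exec_SkipE)
next
  case NWrite then show ?case by (auto elim: exec_NWriteE)
next
  case FWrite then show ?case by (auto elim: exec_FWriteE)
next
  case (Seq c s t s' d u' s3)
  from Seq.prems obtain t2 s2 u2 where "exec w c s t2 s2" "exec w d s2 u2 s''" "u = t2 + u2"
    by (rule exec_SeqE)
  with Seq.IH show ?case by metis
next
  case (CondTrue b s c t s' d)
  from CondTrue.prems CondTrue.hyps obtain t2 where "exec w c s t2 s''" "u = bcost w b s + t2"
    by (auto elim: exec_CondE)
  with CondTrue.IH show ?case by metis
next
  case (CondFalse b s d t s' c)
  from CondFalse.prems CondFalse.hyps obtain t2 where "exec w d s t2 s''" "u = bcost w b s + t2"
    by (auto elim: exec_CondE)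
  with CondFalse.IH show ?case by metis
next
  case WhileFalse then show ?case by (auto elim: exec_WhileE)
next
  case (WhileTrue b s c t s' u' s3)
  from WhileTrue.prems WhileTrue.hyps obtain t2 s2 u2
    where "exec w c s t2 s2" "exec w (While b c) s2 u2 s''" "u = bcost w b s + t2 + u2"
    by (auto elim: exec_WhileE)
  with WhileTrue.IH show ?case by metis
qed

section \<open>Computing exchange-stable arrangements in polynomial time\<close>

text \<open>
  For the input, agents and seats are both numbered \<open>0, \<dots>, n - 1\<close>. Bank \<open>n\<close> holds \<open>n\<close> at
  address 0; bank \<open>adj\<close> holds the adjacency matrix of the seat graph and field bank \<open>val\<close> the
  off-diagonal valuations, both in row-major order. All other cells are 0. The output is read
  from bank \<open>seat\<close>, whose cell \<open>i\<close> holds the seat of agent \<open>i\<close>.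
\<close>

definition input_memory ::
  "nat \<Rightarrow> nat set set \<Rightarrow> (nat \<Rightarrow> nat \<Rightarrow> 'a::linordered_field) \<Rightarrow> 'a memory" where
  "input_memory n E g =
    (\<lambda>x k. if x = ''n'' \<and> k = 0 then n
           else if x = ''adj'' \<and> k < n * n \<and> {k div n, k mod n} \<in> E then 1
           else 0,
     \<lambda>x k. if x = ''val'' \<and> k < n * n \<and> k div n \<noteq> k mod n then g (k div n) (k mod n)
           else 0)"

definition input_size ::
  "('a \<Rightarrow> nat) \<Rightarrow> nat \<Rightarrow> (nat \<Rightarrow> nat \<Rightarrow> 'a) \<Rightarrow> nat" where
  "input_size w n g = bits (int n) + n * n + (\<Sum>i<n. \<Sum>j\<in>{..<n} - {i}. w (g i j))"

text \<open>
  \<open>\<phi>\<close> embeds the field in which the valuations are given into the reals.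
\<close>

definition computes_stable_in_poly_time ::
  "('a::linordered_field \<Rightarrow> nat) \<Rightarrow> ('a \<Rightarrow> real) \<Rightarrow> com \<Rightarrow> bool" where
  "computes_stable_in_poly_time w \<phi> c \<longleftrightarrow>
    (\<exists>q :: nat poly. \<forall>n E (g :: nat \<Rightarrow> nat \<Rightarrow> 'a).
      sa_instance {..<n} {..<n} E \<longrightarrow>
      symmetric_preferences {..<n} (\<lambda>i j. \<phi> (g i j)) \<longrightarrow>
      (\<exists>t s'. exec w c (input_memory n E g) t s' \<and>
        t \<le> poly q (input_size w n g) \<and>
        arrangement {..<n} {..<n} (fst s' ''seat'') \<and>
        exchange_stable {..<n} E (\<lambda>i j. \<phi> (g i j)) (fst s' ''seat'')))"

end

theory Submission imports Defs begin

text \<open>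
  Seat the agents greedily: among all ways to make two agents neighbours, where at least one of
  them is not yet seated and the other is either seated next to a free seat or not seated either,
  choose one of maximal value. Suppose the final arrangement had a blocking pair, and consider the
  moment when the first of the two agents was seated. Both their final seats were still free, so
  both could have been made neighbours of the agents they would like to reach by the exchange;
  hence the value chosen at that moment was at least what either of them gains, and the agent
  seated then has no reason to exchange. (An agent who only gains by moving to an isolated seat has
  negative utility, while the other agent gains a positive value; the latter move is decisive.)
  As every round seats somebody and a brute-force search over two agents and two seats finds the
  best move, this takes polynomial time.
\<close>

section \<open>Greedy seating\<close>

locale symmetric_seat_arrangement =
  fixes P :: "'p set" and V :: "'v set" and E and f :: "'p \<Rightarrow> 'p \<Rightarrow> real"
  assumes sa_inst: "sa_instance P V E" and sym_pref: "symmetric_preferences P f"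
begin

lemma fin_P: "finite P" and fin_V: "finite V" and card_V: "card V = card P"
  using sa_inst by (auto simp: sa_instance_def simple_graph_def)

lemma edge_memD: "{u, v} \<in> E \<Longrightarrow> u \<in> V \<and> v \<in> V \<and> u \<noteq> v"
  using sa_inst unfolding sa_instance_def simple_graph_def by (auto simp: doubleton_eq_iff)

lemma finite_neighbours: "finite (neighbours E v)"
  by (rule finite_subset[OF _ fin_V]) (auto simp: neighbours_def dest: edge_memD)

section \<open>Partial arrangements, their completions and greedy moves\<close>

definition partial_arrangement :: "'p set \<Rightarrow> ('p \<Rightarrow> 'v) \<Rightarrow> bool" where
  "partial_arrangement L \<sigma> \<longleftrightarrow> L \<subseteq> P \<and> inj_on \<sigma> L \<and> \<sigma> ` L \<subseteq> V"

definition completion :: "'p set \<Rightarrow> ('p \<Rightarrow> 'v) \<Rightarrow> ('p \<Rightarrow> 'v) \<Rightarrow> bool" where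
  "completion L \<sigma> \<tau> \<longleftrightarrow> arrangement P V \<tau> \<and> (\<forall>p\<in>L. \<tau> p = \<sigma> p)"

text \<open>Quantifying over all completions makes the property survive every later choice. The sets
  \<open>S\<close> and \<open>L\<close> are kept apart because \<open>S\<close> jumps to all of
  \<open>P\<close> once moves run out, while \<open>L\<close> still grows.\<close>

definition unblocked :: "'p set \<Rightarrow> 'p set \<Rightarrow> ('p \<Rightarrow> 'v) \<Rightarrow> bool" where
  "unblocked S L \<sigma> \<longleftrightarrow>
    (\<forall>\<tau>. completion L \<sigma> \<tau> \<longrightarrow> (\<forall>p\<in>S. \<forall>q. \<not> exchange_blocking P E f \<tau> p q))"

text \<open>Allowing \<open>r\<close> to be seated already, with \<open>u\<close> as its seat, lets
  the update \<open>\<sigma>(p := v, r := u)\<close> serve both kinds of move: for a seated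
  \<open>r\<close> it changes nothing at \<open>r\<close>.\<close>

definition move :: "'p set \<Rightarrow> ('p \<Rightarrow> 'v) \<Rightarrow> 'p \<Rightarrow> 'p \<Rightarrow> 'v \<Rightarrow> 'v \<Rightarrow> bool" where
  "move L \<sigma> p r v u \<longleftrightarrow> p \<in> P - L \<and> r \<in> P \<and> p \<noteq> r \<and> v \<in> V - \<sigma> ` L \<and> {v, u} \<in> E \<and>
    (if r \<in> L then \<sigma> r = u else u \<notin> \<sigma> ` L)"

section \<open>From envy to available moves\<close>

lemma exchange_blocking_sym:
  "exchange_blocking P E f \<tau> p q \<Longrightarrow> exchange_blocking P E f \<tau> q p"
  by (auto simp: exchange_blocking_def)

lemma b_utility_ge:
  assumes "arrangement P V \<tau>" "q \<in> P" "{\<tau> p, \<tau> q} \<in> E"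
  shows "f p q \<le> b_utility P E f \<tau> p"
proof -
  have "the_inv_into P \<tau> (\<tau> q) = q"
    using assms by (intro the_inv_into_f_f) (auto simp: arrangement_def bij_betw_def)
  moreover have "\<tau> q \<in> neighbours E (\<tau> p)"
    using assms by (simp add: neighbours_def)
  ultimately have "f p q \<in> (\<lambda>v. f p (the_inv_into P \<tau> v)) ` neighbours E (\<tau> p)"
    by force
  with finite_neighbours[of "\<tau> p"] show ?thesis
    by (auto simp: b_utility_def intro: Max_ge)
qed

lemma arrangement_swap:
  assumes arr: "arrangement P V \<tau>" and "p \<in> P" "q \<in> P" "p \<noteq> q"
  shows "arrangement P V (swap_seats \<tau> p q)"
proof -
  have inj: "inj_on \<tau> P" and img: "\<tau> ` P = V"
    using arr by (auto simp: arrangement_def bij_betw_def)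
  have "inj_on (swap_seats \<tau> p q) P"
    using inj assms(2-4) by (auto simp: inj_on_def swap_seats_def)
  moreover have "swap_seats \<tau> p q ` P = V"
    unfolding img[symmetric] swap_seats_def using assms(2-4) by (auto simp: image_iff)
  ultimately show ?thesis by (simp add: arrangement_def bij_betw_def)
qed

lemma completion_fresh:
  assumes "completion L \<sigma> \<tau>" "L \<subseteq> P" "p \<in> P - L"
  shows "\<tau> p \<in> V - \<sigma> ` L"
proof -
  have "\<tau> p \<notin> \<tau> ` L"
    using assms inj_on_image_mem_iff[of \<tau> P p L]
    by (auto simp: completion_def arrangement_def bij_betw_def)
  moreover have "\<tau> ` L = \<sigma> ` L"
    using assms(1) by (intro image_cong) (auto simp: completion_def)
  moreover have "\<tau> p \<in> V"
    using assms by (auto simp: completion_def arrangement_def bij_betw_def)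
  ultimately show ?thesis by simp
qed

text \<open>The utility after the exchange is a maximum attained at some \<open>r\<close>. This
  \<open>r\<close> is not \<open>q\<close>, for otherwise the two seats would be adjacent and
  \<open>p\<close> would have had the value \<open>f p q\<close> before. So \<open>r\<close> keeps
  its seat, and \<open>\<tau> q\<close> is still free because \<open>q\<close> is outside
  \<open>L\<close>.\<close>

lemma envied_seat_move:
  assumes compl: "completion L \<sigma> \<tau>" and "L \<subseteq> P" "p \<in> P - L" "q \<in> P - L" "p \<noteq> q"
    and env: "envies P E f \<tau> p q" and nonempty: "neighbours E (\<tau> q) \<noteq> {}"
  shows "\<exists>r v u. move L \<sigma> p r v u \<and> b_utility P E f \<tau> p < f p r"
proof -
  define \<tau>' where "\<tau>' = swap_seats \<tau> p q"
  have arr: "arrangement P V \<tau>" and ext: "\<forall>p\<in>L. \<tau> p = \<sigma> p"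
    using compl by (auto simp: completion_def)
  then have arr': "arrangement P V \<tau>'"
    unfolding \<tau>'_def using assms by (intro arrangement_swap) auto
  have seat': "\<tau>' p = \<tau> q" "\<tau>' q = \<tau> p" "\<And>r. r \<noteq> p \<Longrightarrow> r \<noteq> q \<Longrightarrow> \<tau>' r = \<tau> r"
    using assms by (auto simp: \<tau>'_def swap_seats_def)
  \<comment> \<open>Having neighbours rules out the default utility 0, so the utility is a genuine
    maximum.\<close>
  have "b_utility P E f \<tau>' p \<in> (\<lambda>v. f p (the_inv_into P \<tau>' v)) ` neighbours E (\<tau> q)"
    unfolding b_utility_def seat' using nonempty finite_neighbours
    by (simp only: if_False) (rule Max_in, auto)
  then obtain u where u: "{\<tau> q, u} \<in> E" "b_utility P E f \<tau>' p = f p (the_inv_into P \<tau>' u)"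
    by (auto simp: neighbours_def)
  then have "u \<in> \<tau>' ` P"
    using arr' edge_memD[OF u(1)] by (auto simp: arrangement_def bij_betw_def)
  then obtain r where r: "r \<in> P" "u = \<tau>' r" by auto
  then have "the_inv_into P \<tau>' u = r"
    using arr' by (auto simp: arrangement_def bij_betw_def the_inv_into_f_f)
  with u env have gain: "b_utility P E f \<tau> p < f p r"
    by (simp add: envies_def \<tau>'_def)
  have "r \<noteq> p" using edge_memD[OF u(1)] r seat' by auto
  moreover have "r \<noteq> q"
  proof
    assume "r = q"
    with u r have "{\<tau> p, \<tau> q} \<in> E" by (simp add: seat' insert_commute)
    with b_utility_ge[OF arr, of q p] gain \<open>r = q\<close> assms show False by auto
  qed
  ultimately have ur: "u = \<tau> r" using r seat' by auto
  have "move L \<sigma> p r (\<tau> q) u"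
    using \<open>r \<noteq> p\<close> assms(3) r(1) u(1) completion_fresh[OF compl assms(2), of q]
      completion_fresh[OF compl assms(2), of r] assms(4) ext ur
    by (auto simp: move_def)
  with gain show ?thesis by blast
qed

text \<open>The mover \<open>a\<close> may be either agent. If \<open>\<tau> q\<close> is isolated,
  \<open>p\<close> can envy it only with negative utility, while \<open>q\<close> has utility 0 and
  gains a positive value at \<open>\<tau> p\<close>; so the move of \<open>q\<close> beats the
  utility of \<open>p\<close> as well.\<close>

lemma blocking_pair_move:
  assumes compl: "completion L \<sigma> \<tau>" and "L \<subseteq> P" "p \<notin> L" "q \<notin> L"
    and block: "exchange_blocking P E f \<tau> p q"
  shows "\<exists>a r v u. move L \<sigma> a r v u \<and> b_utility P E f \<tau> p < f a r"
proof -
  have pq: "p \<in> P - L" "q \<in> P - L" "p \<noteq> q"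
    and env: "envies P E f \<tau> p q" "envies P E f \<tau> q p"
    using block assms by (auto simp: exchange_blocking_def)
  show ?thesis
  proof (cases "neighbours E (\<tau> q) = {}")
    case False
    then show ?thesis using envied_seat_move[OF compl assms(2) pq env(1)] by blast
  next
    case True
    then have uq: "b_utility P E f \<tau> q = 0"
      and "b_utility P E f (swap_seats \<tau> p q) p = 0"
      using pq by (auto simp: b_utility_def swap_seats_def)
    then have up: "b_utility P E f \<tau> p < 0" using env by (simp add: envies_def)
    \<comment> \<open>An isolated seat would give utility 0, which is not negative.\<close>
    then have "neighbours E (\<tau> p) \<noteq> {}" by (auto simp: b_utility_def)
    then show ?thesis
      using envied_seat_move[OF compl assms(2) pq(2,1) _ env(2)] pq(3) uq up by fastforce
  qed
qed

section \<open>Best moves preserve the invariant\<close>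

lemma partial_move:
  assumes "partial_arrangement L \<sigma>" "move L \<sigma> p r v u"
  shows "partial_arrangement (insert p (insert r L)) (\<sigma>(p := v, r := u))"
  using assms edge_memD[of v u]
  by (auto simp: partial_arrangement_def move_def inj_on_def split: if_splits)

text \<open>A new blocking agent \<open>a\<close> would have to be \<open>p\<close> or
  \<open>r\<close>, with both members of the pair unseated before. Some move would then exceed the
  utility of \<open>a\<close>, but adjacency and symmetry make that utility at least the maximal
  value \<open>f p r\<close>.\<close>

lemma unblocked_move:
  assumes part: "partial_arrangement L \<sigma>" and good: "unblocked L L \<sigma>"
    and mv: "move L \<sigma> p r v u"
    and best: "\<And>p' r' v' u'. move L \<sigma> p' r' v' u' \<Longrightarrow> f p' r' \<le> f p r"
  shows "unblocked (insert p (insert r L)) (insert p (insert r L)) (\<sigma>(p := v, r := u))"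
  unfolding unblocked_def
proof (intro allI impI ballI notI)
  fix \<tau> a b
  assume compl': "completion (insert p (insert r L)) (\<sigma>(p := v, r := u)) \<tau>"
    and a: "a \<in> insert p (insert r L)" and block: "exchange_blocking P E f \<tau> a b"
  have seats: "\<tau> p = v" "\<tau> r = u" and arr: "arrangement P V \<tau>"
    using compl' mv by (auto simp: completion_def move_def split: if_splits)
  have compl: "completion L \<sigma> \<tau>"
    using compl' mv by (auto simp: completion_def move_def split: if_splits)
  \<comment> \<open>Blocking is symmetric, so the old invariant excludes \<open>L\<close> for both
    members of the pair.\<close>
  have "a \<notin> L" "b \<notin> L"
    using good compl block exchange_blocking_sym[OF block] by (auto simp: unblocked_def)
  moreover have "L \<subseteq> P" using part by (simp add: partial_arrangement_def)
  ultimately obtain a' r' v' u' where "move L \<sigma> a' r' v' u'" "b_utility P E f \<tau> a < f a' r'"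
    using blocking_pair_move[OF compl _ _ _ block] by blast
  with best have less: "b_utility P E f \<tau> a < f p r" by force
  have pr: "p \<in> P" "r \<in> P" "p \<noteq> r" "{v, u} \<in> E" using mv by (auto simp: move_def)
  then have "f p r \<le> b_utility P E f \<tau> p" "f r p \<le> b_utility P E f \<tau> r"
    using b_utility_ge[OF arr] seats by (auto simp: insert_commute)
  moreover have "f p r = f r p"
    using sym_pref pr by (simp add: symmetric_preferences_def)
  ultimately show False using a \<open>a \<notin> L\<close> less by auto
qed

text \<open>Once moves run out, even the agents still unseated cannot block: a blocking pair outside
  \<open>L\<close> would supply a move.\<close>

lemma unblocked_no_move:
  assumes "partial_arrangement L \<sigma>" "unblocked L L \<sigma>" and none: "\<nexists>p r v u. move L \<sigma> p r v u"
  shows "unblocked P L \<sigma>"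
  unfolding unblocked_def
proof (intro allI impI ballI notI)
  fix \<tau> p q assume compl: "completion L \<sigma> \<tau>" and block: "exchange_blocking P E f \<tau> p q"
  have "p \<notin> L" "q \<notin> L"
    using assms(2) compl block exchange_blocking_sym[OF block] by (auto simp: unblocked_def)
  moreover have "L \<subseteq> P" using assms(1) by (simp add: partial_arrangement_def)
  ultimately show False using blocking_pair_move[OF compl _ _ _ block] none by blast
qed

section \<open>From partial to complete arrangements\<close>

lemma unblocked_extend:
  assumes "unblocked P L \<sigma>" "L \<subseteq> L'" "\<And>p. p \<in> L \<Longrightarrow> \<sigma>' p = \<sigma> p"
  shows "unblocked P L' \<sigma>'"
  using assms unfolding unblocked_def completion_def by fastforce

text \<open>Injectivity and equal cardinality leave no seat empty.\<close>

lemma partial_complete: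
  assumes "partial_arrangement P \<sigma>"
  shows "arrangement P V \<sigma>"
proof -
  from assms have inj: "inj_on \<sigma> P" and sub: "\<sigma> ` P \<subseteq> V"
    by (auto simp: partial_arrangement_def)
  have "\<sigma> ` P = V"
    using card_subset_eq[OF fin_V sub] card_image[OF inj] card_V by simp
  with inj show ?thesis by (simp add: arrangement_def bij_betw_def)
qed

text \<open>A complete arrangement is its own completion.\<close>

lemma unblocked_stable:
  assumes "partial_arrangement P \<sigma>" "unblocked P P \<sigma>"
  shows "exchange_stable P E f \<sigma>"
  using assms partial_complete[OF assms(1)]
  by (auto simp: unblocked_def completion_def exchange_stable_def exchange_blocking_def)

lemma partial_free_seat:
  assumes "partial_arrangement L \<sigma>" "p \<in> P - L"
  shows "\<exists>v\<in>V. v \<notin> \<sigma> ` L"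
proof (rule ccontr)
  assume "\<not> ?thesis"
  with assms have "\<sigma> ` L = V" by (auto simp: partial_arrangement_def)
  then have "card L = card P"
    using assms card_V card_image[of \<sigma> L] by (simp add: partial_arrangement_def)
  then have "L = P"
    using assms fin_P by (intro card_subset_eq) (auto simp: partial_arrangement_def)
  with assms show False by auto
qed

lemma partial_insert:
  assumes "partial_arrangement L \<sigma>" "p \<in> P - L" "v \<in> V - \<sigma> ` L"
  shows "partial_arrangement (insert p L) (\<sigma>(p := v))"
  using assms by (auto simp: partial_arrangement_def inj_on_def)

text \<open>Enlarging a partial arrangement only removes completions, so the remaining agents may
  take any free seats.\<close>

lemma partial_fill:
  "partial_arrangement L \<sigma> \<Longrightarrow> unblocked P L \<sigma> \<Longrightarrow>
    \<exists>\<sigma>'. arrangement P V \<sigma>' \<and> exchange_stable P E f \<sigma>'"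
proof (induction "card (P - L)" arbitrary: L \<sigma> rule: less_induct)
  case less
  show ?case
  proof (cases "L = P")
    case True
    with less.prems partial_complete unblocked_stable show ?thesis by blast
  next
    case False
    with less.prems(1) obtain p where p: "p \<in> P - L" by (auto simp: partial_arrangement_def)
    with partial_free_seat[OF less.prems(1)] obtain v where "v \<in> V - \<sigma> ` L" by auto
    with p have pv: "p \<in> P - L" "v \<in> V - \<sigma> ` L" by auto
    have "card (P - insert p L) < card (P - L)"
      using fin_P pv by (intro psubset_card_mono) auto
    moreover have "unblocked P (insert p L) (\<sigma>(p := v))"
      using pv by (intro unblocked_extend[OF less.prems(2)]) auto
    ultimately show ?thesis
      using less.hyps[OF _ partial_insert[OF less.prems(1) pv]] by simp
  qed
qed

lemma greedy_completion:
  "partial_arrangement L \<sigma> \<Longrightarrow> unblocked L L \<sigma> \<Longrightarrow>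
    \<exists>\<sigma>'. arrangement P V \<sigma>' \<and> exchange_stable P E f \<sigma>'"
proof (induction "card (P - L)" arbitrary: L \<sigma> rule: less_induct)
  case less
  \<comment> \<open>The value of a move depends on its two agents only, so maximising over pairs
    suffices.\<close>
  define M where "M = {(p, r). \<exists>v u. move L \<sigma> p r v u}"
  show ?case
  proof (cases "M = {}")
    case True
    then show ?thesis
      using unblocked_no_move[OF less.prems] partial_fill[OF less.prems(1)]
      unfolding M_def by blast
  next
    case False
    have "M \<subseteq> P \<times> P" by (auto simp: M_def move_def)
    then have fin: "finite M" using fin_P by (meson finite_SigmaI finite_subset)
    have "Max (case_prod f ` M) \<in> case_prod f ` M"
      using fin False by (intro Max_in) auto
    then obtain m where m: "m \<in> M" "case_prod f m = Max (case_prod f ` M)"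
      by (elim imageE) simp
    then have best: "case_prod f m' \<le> case_prod f m" if "m' \<in> M" for m'
      using that fin by simp
    from m(1) obtain p r v u where mv: "move L \<sigma> p r v u" "m = (p, r)" by (auto simp: M_def)
    have "card (P - insert p (insert r L)) < card (P - L)"
      using fin_P mv by (intro psubset_card_mono) (auto simp: move_def)
    moreover have "unblocked (insert p (insert r L)) (insert p (insert r L)) (\<sigma>(p := v, r := u))"
    proof (rule unblocked_move[OF less.prems mv(1)])
      fix p' r' v' u' assume "move L \<sigma> p' r' v' u'"
      then have "(p', r') \<in> M" by (auto simp: M_def)
      from best[OF this] show "f p' r' \<le> f p r" by (simp add: mv)
    qed
    ultimately show ?thesis
      using less.hyps[OF _ partial_move[OF less.prems(1) mv(1)]] by simp
  qed
qed

lemma exchange_stable_exists: "\<exists>\<sigma>. arrangement P V \<sigma> \<and> exchange_stable P E f \<sigma>"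
  \<comment> \<open>With nobody seated the seat function is arbitrary and both invariants hold
    vacuously.\<close>
  using greedy_completion[of "{}" undefined]
  by (simp add: partial_arrangement_def unblocked_def)

end

section \<open>Cost-bounded execution\<close>

primrec nval_bound :: "nat \<Rightarrow> nexp \<Rightarrow> nat" where
  "nval_bound N (NConst k) = k"
| "nval_bound N (NRead x e) = N"
| "nval_bound N (NAdd d e) = nval_bound N d + nval_bound N e"
| "nval_bound N (NSub d e) = nval_bound N d"
| "nval_bound N (NMul d e) = nval_bound N d * nval_bound N e"

text \<open>The binary length of a number is replaced by the number plus 1. This crude bound stays
  polynomial because stored numbers are assumed to be at most \<open>N\<close>.\<close>

primrec ncost_bound :: "nat \<Rightarrow> nexp \<Rightarrow> nat" where
  "ncost_bound N (NConst k) = k + 1"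
| "ncost_bound N (NRead x e) = ncost_bound N e + N + 1"
| "ncost_bound N (NAdd d e) =
    ncost_bound N d + ncost_bound N e + nval_bound N d + nval_bound N e + 1"
| "ncost_bound N (NSub d e) = ncost_bound N d + ncost_bound N e + nval_bound N d + 1"
| "ncost_bound N (NMul d e) =
    ncost_bound N d + ncost_bound N e + nval_bound N d * nval_bound N e + 1"

text \<open>
  Only those programs matter that never compute with field elements, but merely compare stored
  ones; for the remaining constructors the bounds are dummies.
\<close>

definition fcost_bound :: "nat \<Rightarrow> fexp \<Rightarrow> nat" where
  "fcost_bound N e = (case e of FRead x d \<Rightarrow> ncost_bound N d + N | _ \<Rightarrow> 0)"

primrec bcost_bound :: "nat \<Rightarrow> bexp \<Rightarrow> nat" where
  "bcost_bound N (NLess d e) = ncost_bound N d + ncost_bound N e + 1"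
| "bcost_bound N (FLess d e) = fcost_bound N d + fcost_bound N e + 1"
| "bcost_bound N (BNot b) = bcost_bound N b + 1"
| "bcost_bound N (BAnd b c) = bcost_bound N b + bcost_bound N c + 1"

primrec comparison_only :: "bexp \<Rightarrow> bool" where
  "comparison_only (NLess d e) \<longleftrightarrow> True"
| "comparison_only (FLess d e) \<longleftrightarrow> (\<exists>x i y j. d = FRead x i \<and> e = FRead y j)"
| "comparison_only (BNot b) \<longleftrightarrow> comparison_only b"
| "comparison_only (BAnd b c) \<longleftrightarrow> comparison_only b \<and> comparison_only c"

text \<open>In the next bound, every loop is charged for \<open>N\<close> iterations.\<close>

primrec com_cost_bound :: "nat \<Rightarrow> com \<Rightarrow> nat" where
  "com_cost_bound N Skip = 1"
| "com_cost_bound N (NWrite x d e) = ncost_bound N d + ncost_bound N e + 1"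
| "com_cost_bound N (FWrite x d e) = 0"
| "com_cost_bound N (Seq c d) = com_cost_bound N c + com_cost_bound N d"
| "com_cost_bound N (Cond b c d) = bcost_bound N b + com_cost_bound N c + com_cost_bound N d"
| "com_cost_bound N (While b c) = bcost_bound N b + N * (bcost_bound N b + com_cost_bound N c)"

section \<open>The cost bounds are polynomial\<close>

definition polynomial_fun :: "(nat \<Rightarrow> nat) \<Rightarrow> bool" where
  "polynomial_fun h \<longleftrightarrow> (\<exists>q. \<forall>x. h x = poly q x)"

lemma polynomial_fun_const: "polynomial_fun (\<lambda>x. k)"
  unfolding polynomial_fun_def by (rule exI[of _ "[:k:]"]) simp

lemma polynomial_fun_id: "polynomial_fun (\<lambda>x. x)"
  unfolding polynomial_fun_def by (rule exI[of _ "[:0, 1:]"]) simp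

lemma polynomial_fun_add:
  "polynomial_fun g \<Longrightarrow> polynomial_fun h \<Longrightarrow> polynomial_fun (\<lambda>x. g x + h x)"
  unfolding polynomial_fun_def by (metis poly_add)

lemma polynomial_fun_mult:
  "polynomial_fun g \<Longrightarrow> polynomial_fun h \<Longrightarrow> polynomial_fun (\<lambda>x. g x * h x)"
  unfolding polynomial_fun_def by (metis poly_mult)

lemmas polynomial_fun_intros =
  polynomial_fun_const polynomial_fun_id polynomial_fun_add polynomial_fun_mult

lemma polynomial_nval_bound: "polynomial_fun (\<lambda>N. nval_bound N e)"
  by (induction e) (auto intro!: polynomial_fun_intros)

lemma polynomial_ncost_bound: "polynomial_fun (\<lambda>N. ncost_bound N e)"
  by (induction e) (simp only: ncost_bound.simps,
      (intro polynomial_fun_intros polynomial_nval_bound | assumption)+)+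

lemma polynomial_fcost_bound: "polynomial_fun (\<lambda>N. fcost_bound N e)"
  by (cases e) (simp_all add: fcost_bound_def polynomial_fun_intros polynomial_ncost_bound)

lemma polynomial_bcost_bound: "polynomial_fun (\<lambda>N. bcost_bound N b)"
  by (induction b) (simp only: bcost_bound.simps,
      (intro polynomial_fun_intros polynomial_ncost_bound polynomial_fcost_bound | assumption)+)+

text \<open>The nesting depth of loops is fixed by the program and each \<open>While\<close>
  contributes one factor \<open>N\<close>, so the degree does not depend on the input.\<close>

lemma polynomial_com_cost_bound: "polynomial_fun (\<lambda>N. com_cost_bound N c)"
  by (induction c) (simp only: com_cost_bound.simps,
      (intro polynomial_fun_intros polynomial_ncost_bound polynomial_bcost_bound | assumption)+)+

section \<open>Evaluation and execution in bounded memories\<close>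

lemma bits_le: "bits (int k) \<le> k + 1"
proof -
  have "bitlen (int k) \<le> int k"
    using less_exp[of k] by (simp add: bitlen_le_iff_power)
  then show ?thesis by (simp add: bits_def)
qed

text \<open>All cells are included, so \<open>N\<close> must also dominate the weight of the default
  value 0.\<close>

definition bounded_memory :: "('a \<Rightarrow> nat) \<Rightarrow> nat \<Rightarrow> 'a memory \<Rightarrow> bool" where
  "bounded_memory w N s \<longleftrightarrow> (\<forall>x k. fst s x k \<le> N \<and> w (snd s x k) \<le> N)"

lemma nval_le: "bounded_memory w N s \<Longrightarrow> nval e s \<le> nval_bound N e"
  by (induction e) (auto simp: bounded_memory_def intro: add_mono mult_le_mono le_trans[OF diff_le_self])

lemma ncost_le:
  assumes "bounded_memory w N s"
  shows "ncost e s \<le> ncost_bound N e"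
proof (induction e)
  case (NConst k)
  then show ?case using bits_le by simp
next
  case (NRead x e)
  have "bits (int (nval (NRead x e) s)) \<le> N + 1"
    using bits_le nval_le[OF assms, of "NRead x e"] by (metis add_le_mono1 le_trans nval_bound.simps(2))
  with NRead show ?case by simp
next
  case (NAdd d e)
  then show ?case
    using bits_le[of "nval d s + nval e s"] nval_le[OF assms, of d] nval_le[OF assms, of e] by simp
next
  case (NSub d e)
  then show ?case
    using bits_le[of "nval d s - nval e s"] nval_le[OF assms, of d] by simp
next
  case (NMul d e)
  then show ?case
    using bits_le[of "nval d s * nval e s"]
      mult_le_mono[OF nval_le[OF assms, of d] nval_le[OF assms, of e]] by simp
qed

lemma bcost_le:
  assumes "bounded_memory w N s"
  shows "comparison_only b \<Longrightarrow> bcost w b s \<le> bcost_bound N b"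
proof (induction b)
  case (NLess d e)
  then show ?case using ncost_le[OF assms] by (simp add: add_mono)
next
  case (FLess d e)
  then obtain x i y j where de: "d = FRead x i" "e = FRead y j" by auto
  have "w (snd s x (nval i s)) \<le> N" "w (snd s y (nval j s)) \<le> N"
    using assms by (auto simp: bounded_memory_def)
  then show ?case
    using ncost_le[OF assms, of i] ncost_le[OF assms, of j] by (simp add: de fcost_bound_def)
qed auto

text \<open>A total-correctness judgement for a single start state. Boundedness is assumed on entry
  and promised on exit, so it travels through a program without appearing in
  \<open>Q\<close>.\<close>

definition achieves ::
  "('a::linordered_field \<Rightarrow> nat) \<Rightarrow> nat \<Rightarrow> com \<Rightarrow> 'a memory \<Rightarrow> ('a memory \<Rightarrow> bool) \<Rightarrow> bool" where
  "achieves w N c s Q \<longleftrightarrow> (bounded_memory w N s \<longrightarrow>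
    (\<exists>t s'. exec w c s t s' \<and> t \<le> com_cost_bound N c \<and> bounded_memory w N s' \<and> Q s'))"

lemma achieves_conseq: "achieves w N c s Q \<Longrightarrow> (\<And>s'. Q s' \<Longrightarrow> R s') \<Longrightarrow> achieves w N c s R"
  unfolding achieves_def by blast

lemma achieves_Skip: "Q s \<Longrightarrow> achieves w N Skip s Q"
  unfolding achieves_def using exec.Skip by fastforce

text \<open>Only the stored value has to respect \<open>N\<close>; addresses and intermediate
  results may exceed it, their cost being covered by \<open>ncost_bound\<close>.\<close>

lemma achieves_NWrite:
  assumes "nval e s \<le> N" "Q (nwrite x (nval d s) (nval e s) s)"
  shows "achieves w N (NWrite x d e) s Q"
  unfolding achieves_def
proof
  assume b: "bounded_memory w N s"
  then have "bounded_memory w N (nwrite x (nval d s) (nval e s) s)"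
    using assms(1) by (auto simp: bounded_memory_def nwrite_def)
  moreover have "ncost d s + ncost e s + 1 \<le> com_cost_bound N (NWrite x d e)"
    using ncost_le[OF b, of d] ncost_le[OF b, of e] by simp
  ultimately show "\<exists>t s'. exec w (NWrite x d e) s t s' \<and> t \<le> com_cost_bound N (NWrite x d e) \<and>
      bounded_memory w N s' \<and> Q s'"
    using assms(2) exec.NWrite by blast
qed

lemma achieves_Seq:
  assumes "achieves w N c s (\<lambda>s'. achieves w N d s' Q)"
  shows "achieves w N (Seq c d) s Q"
  unfolding achieves_def
proof
  assume "bounded_memory w N s"
  with assms obtain t s' u s'' where "exec w c s t s'" "t \<le> com_cost_bound N c"
    "exec w d s' u s''" "u \<le> com_cost_bound N d" "bounded_memory w N s''" "Q s''"
    unfolding achieves_def by blast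
  then show "\<exists>t s'. exec w (Seq c d) s t s' \<and> t \<le> com_cost_bound N (Seq c d) \<and>
      bounded_memory w N s' \<and> Q s'"
    by (intro exI[of _ "t + u"] exI[of _ s''] conjI exec.Seq) auto
qed

lemma achieves_Cond:
  assumes "comparison_only b" and "bval b s \<Longrightarrow> achieves w N c s Q"
    and "\<not> bval b s \<Longrightarrow> achieves w N d s Q"
  shows "achieves w N (Cond b c d) s Q"
  unfolding achieves_def
proof
  assume bd: "bounded_memory w N s"
  show "\<exists>t s'. exec w (Cond b c d) s t s' \<and> t \<le> com_cost_bound N (Cond b c d) \<and>
      bounded_memory w N s' \<and> Q s'"
  proof (cases "bval b s")
    case True
    with assms(2) bd obtain t s' where "exec w c s t s'" "t \<le> com_cost_bound N c"
      "bounded_memory w N s'" "Q s'"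
      unfolding achieves_def by blast
    with True bcost_le[OF bd assms(1)] show ?thesis
      by (intro exI[of _ "bcost w b s + t"] exI[of _ s'] conjI exec.CondTrue) auto
  next
    case False
    with assms(3) bd obtain t s' where "exec w d s t s'" "t \<le> com_cost_bound N d"
      "bounded_memory w N s'" "Q s'"
      unfolding achieves_def by blast
    with False bcost_le[OF bd assms(1)] show ?thesis
      by (intro exI[of _ "bcost w b s + t"] exI[of _ s'] conjI exec.CondFalse) auto
  qed
qed

text \<open>The index of \<open>I\<close> counts iterations, and exactly \<open>n\<close> of them
  take place; by \<open>n \<le> N\<close> the \<open>N\<close> iterations charged in
  \<open>com_cost_bound\<close> suffice.\<close>

lemma achieves_While:
  assumes "comparison_only b" "n \<le> N"
    and step: "\<And>i s. i < n \<Longrightarrow> I i s \<Longrightarrow> bval b s \<and> achieves w N c s (I (Suc i))"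
    and stop: "\<And>s. I n s \<Longrightarrow> \<not> bval b s"
    and "I 0 s"
  shows "achieves w N (While b c) s (I n)"
  unfolding achieves_def
proof
  assume bd: "bounded_memory w N s"
  define B where "B = bcost_bound N b"
  define C where "C = B + com_cost_bound N c"
  \<comment> \<open>Here \<open>k\<close> counts the iterations still to come, so the invariant is
    taken at \<open>n - k\<close>. The summand \<open>B\<close> pays for the last, failing
    test.\<close>
  have "\<exists>t s'. exec w (While b c) s t s' \<and> t \<le> B + k * C \<and> bounded_memory w N s' \<and> I n s'"
    if "k \<le> n" "I (n - k) s" "bounded_memory w N s" for k s
    using that
  proof (induction k arbitrary: s)
    case 0
    then have "exec w (While b c) s (bcost w b s) s"
      using stop by (intro exec.WhileFalse) simp
    moreover have "bcost w b s \<le> B"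
      unfolding B_def using 0 by (intro bcost_le[OF _ assms(1)])
    ultimately show ?case using 0 by (intro exI[of _ "bcost w b s"] exI[of _ s]) simp
  next
    case (Suc k)
    have i: "n - Suc k < n" "Suc (n - Suc k) = n - k" using Suc.prems by auto
    note st = step[OF i(1) Suc.prems(2)]
    then obtain t s' where body: "exec w c s t s'" "t \<le> com_cost_bound N c"
      "bounded_memory w N s'" "I (n - k) s'"
      unfolding achieves_def i(2) using Suc.prems by blast
    then obtain u s'' where rest: "exec w (While b c) s' u s''" "u \<le> B + k * C"
      "bounded_memory w N s''" "I n s''"
      using Suc.IH[of s'] Suc.prems by auto
    have "bcost w b s \<le> B"
      unfolding B_def using Suc.prems by (intro bcost_le[OF _ assms(1)])
    then have "bcost w b s + t + u \<le> B + Suc k * C"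
      using body rest by (simp add: C_def)
    moreover have "exec w (While b c) s (bcost w b s + t + u) s''"
      using st body rest by (intro exec.WhileTrue) auto
    ultimately show ?case using rest by blast
  qed
  from this[of n s] bd assms(5) obtain t s' where "exec w (While b c) s t s'"
    "t \<le> B + n * C" "bounded_memory w N s'" "I n s'" by auto
  moreover have "B + n * C \<le> com_cost_bound N (While b c)"
    using assms(2) by (simp add: B_def C_def)
  ultimately show "\<exists>t s'. exec w (While b c) s t s' \<and> t \<le> com_cost_bound N (While b c) \<and>
      bounded_memory w N s' \<and> I n s'"
    by (meson le_trans)
qed

section \<open>Derived program constructs and counting loops\<close>

lemma fst_nwrite:
  "fst (nwrite x i k s) y = (if y = x then (fst s x)(i := k) else fst s y)"
  by (simp add: nwrite_def)

lemma snd_nwrite: "snd (nwrite x i k s) = snd s"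
  by (simp add: nwrite_def)

lemmas nwrite_simps = fst_nwrite snd_nwrite

abbreviation NVar :: "string \<Rightarrow> nexp" where
  "NVar x \<equiv> NRead x (NConst 0)"

abbreviation NAssign :: "string \<Rightarrow> nexp \<Rightarrow> com" where
  "NAssign x e \<equiv> NWrite x (NConst 0) e"

definition NEq :: "nexp \<Rightarrow> nexp \<Rightarrow> bexp" where
  "NEq d e = BAnd (BNot (NLess d e)) (BNot (NLess e d))"

definition BOr :: "bexp \<Rightarrow> bexp \<Rightarrow> bexp" where
  "BOr b c = BNot (BAnd (BNot b) (BNot c))"

lemma bval_NEq: "bval (NEq d e) s \<longleftrightarrow> nval d s = nval e s"
  by (auto simp: NEq_def)

lemma bval_BOr: "bval (BOr b c) s \<longleftrightarrow> bval b s \<or> bval c s"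
  by (simp add: BOr_def)

lemma comparison_only_NEq: "comparison_only (NEq d e)"
  by (simp add: NEq_def)

lemma comparison_only_BOr: "comparison_only (BOr b c) \<longleftrightarrow> comparison_only b \<and> comparison_only c"
  by (simp add: BOr_def)

definition For :: "string \<Rightarrow> com \<Rightarrow> com" where
  "For x c = Seq (NAssign x (NConst 0)) (While (NLess (NVar x) (NVar ''n''))
     (Seq c (NAssign x (NAdd (NVar x) (NConst 1)))))"

text \<open>The body must leave the counter alone, and \<open>I\<close> must survive any write to
  the counter. The equation between counter and index is therefore added separately to the loop
  invariant.\<close>

lemma achieves_For:
  assumes "x \<noteq> ''n''" "n \<le> N"
    and step: "\<And>i s. i < n \<Longrightarrow> I i s \<Longrightarrow> fst s x 0 = i \<Longrightarrow>
      achieves w N c s (\<lambda>s'. I (Suc i) s' \<and> fst s' x 0 = i)"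
    and size: "\<And>i s. I i s \<Longrightarrow> fst s ''n'' 0 = n"
    and stable: "\<And>i s k. I i s \<Longrightarrow> I i (nwrite x 0 k s)"
    and "I 0 s"
  shows "achieves w N (For x c) s (I n)"
proof -
  let ?I = "\<lambda>i s. I i s \<and> fst s x 0 = i"
  have "achieves w N (While (NLess (NVar x) (NVar ''n''))
     (Seq c (NAssign x (NAdd (NVar x) (NConst 1))))) (nwrite x 0 0 s) (?I n)"
  proof (rule achieves_While[where I = ?I])
    fix i s assume i: "i < n" "?I i s"
    \<comment> \<open>The counter never exceeds \<open>n\<close>, so \<open>n \<le> N\<close>
      permits the write.\<close>
    have "achieves w N (NAssign x (NAdd (NVar x) (NConst 1))) s' (?I (Suc i))"
      if "I (Suc i) s'" "fst s' x 0 = i" for s'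
      using that i assms(2) stable by (intro achieves_NWrite) (auto simp: nwrite_simps)
    then have "achieves w N (Seq c (NAssign x (NAdd (NVar x) (NConst 1)))) s (?I (Suc i))"
      using i by (intro achieves_Seq achieves_conseq[OF step]) auto
    moreover have "fst s ''n'' 0 = n" using i size by blast
    ultimately show "bval (NLess (NVar x) (NVar ''n'')) s \<and>
        achieves w N (Seq c (NAssign x (NAdd (NVar x) (NConst 1)))) s (?I (Suc i))"
      using i by simp
  qed (use assms size in \<open>auto simp: nwrite_simps\<close>)
  then show ?thesis
    unfolding For_def
    by (intro achieves_Seq achieves_NWrite) (auto elim: achieves_conseq)
qed

text \<open>
  An invariant indexed by the set of items processed so far composes under nesting of loops.
\<close>

lemma achieves_For_Union:
  assumes "x \<noteq> ''n''" "n \<le> N"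
    and step: "\<And>i D s. i < n \<Longrightarrow> J D s \<Longrightarrow> fst s x 0 = i \<Longrightarrow>
      achieves w N c s (\<lambda>s'. J (D \<union> A i) s' \<and> fst s' x 0 = i)"
    and size: "\<And>D s. J D s \<Longrightarrow> fst s ''n'' 0 = n"
    and stable: "\<And>D s k. J D s \<Longrightarrow> J D (nwrite x 0 k s)"
    and "J D s"
  shows "achieves w N (For x c) s (J (D \<union> (\<Union>i<n. A i)))"
proof (rule achieves_For[where I = "\<lambda>i. J (D \<union> (\<Union>j<i. A j))"])
  fix i s assume "i < n" "J (D \<union> (\<Union>j<i. A j)) s" "fst s x 0 = i"
  from step[OF this]
  show "achieves w N c s (\<lambda>s'. J (D \<union> (\<Union>j<Suc i. A j)) s' \<and> fst s' x 0 = i)"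
    by (simp add: lessThan_Suc Un_ac)
qed (use assms in auto)


section \<open>The greedy program\<close>

definition cell :: "nexp \<Rightarrow> nexp \<Rightarrow> nexp" where
  "cell i j = NAdd (NMul i (NVar ''n'')) j"

text \<open>Separate flags are kept because seat 0 is also the initial content of every
  \<open>seat\<close> cell, so that bank alone does not show who is seated.\<close>

definition place :: "nexp \<Rightarrow> nexp \<Rightarrow> com" where
  "place a b = Seq (NWrite ''seat'' a b)
     (Seq (NWrite ''placed'' a (NConst 1)) (NWrite ''taken'' b (NConst 1)))"

text \<open>The program version of \<open>move\<close>. The \<open>seat\<close> cell of
  \<open>r\<close> counts only together with its \<open>placed\<close> flag.\<close>

definition admissible :: bexp where
  "admissible =
    BAnd (NEq (NRead ''placed'' (NVar ''p'')) (NConst 0))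
    (BAnd (NEq (NRead ''taken'' (NVar ''v'')) (NConst 0))
    (BAnd (NLess (NConst 0) (NRead ''adj'' (cell (NVar ''v'') (NVar ''u''))))
    (BAnd (BNot (NEq (NVar ''p'') (NVar ''r'')))
    (BOr
      (BAnd (NEq (NRead ''placed'' (NVar ''r'')) (NConst 0))
        (NEq (NRead ''taken'' (NVar ''u'')) (NConst 0)))
      (BAnd (NLess (NConst 0) (NRead ''placed'' (NVar ''r'')))
        (NEq (NRead ''seat'' (NVar ''r'')) (NVar ''u'')))))))"

text \<open>Before the first hit of a round, \<open>bp\<close> and \<open>br\<close> may hold
  leftovers of earlier rounds, so a cleared \<open>found\<close> overrides the comparison.\<close>

definition improving :: bexp where
  "improving = BOr (NEq (NVar ''found'') (NConst 0))
     (FLess (FRead ''val'' (cell (NVar ''bp'') (NVar ''br'')))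
       (FRead ''val'' (cell (NVar ''p'') (NVar ''r''))))"

definition record_move :: com where
  "record_move = Seq (NAssign ''found'' (NConst 1)) (Seq (NAssign ''bp'' (NVar ''p''))
     (Seq (NAssign ''br'' (NVar ''r'')) (Seq (NAssign ''bv'' (NVar ''v''))
       (NAssign ''bu'' (NVar ''u'')))))"

definition examine :: com where
  "examine = Cond (BAnd admissible improving) record_move Skip"

definition search :: com where
  "search = For ''p'' (For ''r'' (For ''v'' (For ''u'' examine)))"

definition greedy_round :: com where
  "greedy_round = Seq (NAssign ''found'' (NConst 0)) (Seq search
     (Cond (NLess (NConst 0) (NVar ''found''))
       (Seq (place (NVar ''bp'') (NVar ''bv'')) (place (NVar ''br'') (NVar ''bu''))) Skip))"

definition fill_seat :: com where
  "fill_seat = Cond (BAnd (NEq (NRead ''placed'' (NVar ''p'')) (NConst 0))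
       (NEq (NRead ''taken'' (NVar ''v'')) (NConst 0)))
     (place (NVar ''p'') (NVar ''v'')) Skip"

text \<open>A round that finds a move seats at least one agent, so \<open>n\<close> rounds exhaust
  the moves; surplus rounds change no seat.\<close>

definition greedy_program :: com where
  "greedy_program = Seq (For ''i'' greedy_round) (For ''p'' (For ''v'' fill_seat))"

text \<open>The program compares values of type \<open>'a\<close>, and \<open>mono\<close> transfers
  maximality to their images under \<open>\<phi>\<close>. The bound \<open>1 \<le> N\<close> admits
  the flag value 1.\<close>

locale greedy_run =
  fixes n :: nat and E and g :: "nat \<Rightarrow> nat \<Rightarrow> 'a::linordered_field"
    and w :: "'a \<Rightarrow> nat" and \<phi> :: "'a \<Rightarrow> real" and N :: nat
  assumes inst: "sa_instance {..<n} {..<n} E"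
    and symm: "symmetric_preferences {..<n} (\<lambda>i j. \<phi> (g i j))"
    and mono: "\<And>x y. \<phi> x < \<phi> y \<longleftrightarrow> x < y"
    and n_le: "n \<le> N" and N_pos: "1 \<le> N"
begin

sublocale symmetric_seat_arrangement "{..<n}" "{..<n}" E "\<lambda>i j. \<phi> (g i j)"
  using inst symm by unfold_locales

lemma mono_le: "\<phi> x \<le> \<phi> y \<longleftrightarrow> x \<le> y"
  using mono by (metis not_le)

section \<open>Seatings represented in memory\<close>

definition input_kept :: "'a memory \<Rightarrow> bool" where
  "input_kept s \<longleftrightarrow> fst s ''n'' 0 = n \<and> fst s ''adj'' = fst (input_memory n E g) ''adj'' \<and>
    snd s = snd (input_memory n E g)"

text \<open>Here \<open>\<sigma>\<close> is the whole bank \<open>seat\<close>, including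
  meaningless cells outside \<open>L\<close>; \<open>move\<close> and
  \<open>partial_arrangement\<close> look at it on \<open>L\<close> only.\<close>

definition seating :: "nat set \<Rightarrow> (nat \<Rightarrow> nat) \<Rightarrow> 'a memory \<Rightarrow> bool" where
  "seating L \<sigma> s \<longleftrightarrow> input_kept s \<and> fst s ''seat'' = \<sigma> \<and>
    (\<forall>p<n. fst s ''placed'' p = 0 \<longleftrightarrow> p \<notin> L) \<and> (\<forall>v<n. fst s ''taken'' v = 0 \<longleftrightarrow> v \<notin> \<sigma> ` L)"

lemma cell_less: "i < n \<Longrightarrow> j < n \<Longrightarrow> i * n + j < n * n"
  by (metis add.commute add_less_cancel_left le_trans less_le_trans mult.commute mult_Suc
      mult_le_mono2 Suc_leI order_refl)

lemma adj_cell: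
  "input_kept s \<Longrightarrow> i < n \<Longrightarrow> j < n \<Longrightarrow> 0 < fst s ''adj'' (i * n + j) \<longleftrightarrow> {i, j} \<in> E"
  using cell_less[of i j] by (simp add: input_kept_def input_memory_def)

lemma val_cell:
  "input_kept s \<Longrightarrow> i < n \<Longrightarrow> j < n \<Longrightarrow> i \<noteq> j \<Longrightarrow> snd s ''val'' (i * n + j) = g i j"
  using cell_less[of i j] by (simp add: input_kept_def input_memory_def)

lemma seating_size: "seating L \<sigma> s \<Longrightarrow> fst s ''n'' 0 = n"
  by (simp add: seating_def input_kept_def)

text \<open>Hence four loops over \<open>{..<n}\<close> meet every move, and its two agents address
  an off-diagonal valuation.\<close>

lemma move_less: "move L \<sigma> p r v u \<Longrightarrow> p < n \<and> r < n \<and> v < n \<and> u < n \<and> p \<noteq> r"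
  using edge_memD[of v u] by (auto simp: move_def)

lemma bval_admissible:
  assumes "seating L \<sigma> s" and "fst s ''p'' 0 = p" "fst s ''r'' 0 = r" "fst s ''v'' 0 = v"
    "fst s ''u'' 0 = u" and "p < n" "r < n" "v < n" "u < n"
  shows "bval admissible s \<longleftrightarrow> move L \<sigma> p r v u"
proof -
  have "fst s ''n'' 0 = n" "input_kept s" "fst s ''seat'' = \<sigma>"
    and "fst s ''placed'' p = 0 \<longleftrightarrow> p \<notin> L" "fst s ''placed'' r = 0 \<longleftrightarrow> r \<notin> L"
    and "fst s ''taken'' v = 0 \<longleftrightarrow> v \<notin> \<sigma> ` L" "fst s ''taken'' u = 0 \<longleftrightarrow> u \<notin> \<sigma> ` L"
    using assms by (auto simp: seating_def input_kept_def)
  then show ?thesis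
    using assms(2-) adj_cell[of s v u]
    by (cases "r \<in> L") (auto simp: admissible_def bval_NEq bval_BOr cell_def move_def)
qed

section \<open>Exhaustive search for a best move\<close>

definition searched ::
  "nat \<Rightarrow> nat set \<Rightarrow> (nat \<Rightarrow> nat) \<Rightarrow> (nat \<times> nat \<times> nat \<times> nat) set \<Rightarrow> 'a memory \<Rightarrow> bool" where
  "searched k L \<sigma> D s \<longleftrightarrow> seating L \<sigma> s \<and> fst s ''i'' 0 = k \<and>
    (if fst s ''found'' 0 = 0 then \<forall>(p, r, v, u)\<in>D. \<not> move L \<sigma> p r v u
     else move L \<sigma> (fst s ''bp'' 0) (fst s ''br'' 0) (fst s ''bv'' 0) (fst s ''bu'' 0) \<and>
       (\<forall>(p, r, v, u)\<in>D. move L \<sigma> p r v u \<longrightarrow> g p r \<le> g (fst s ''bp'' 0) (fst s ''br'' 0)))"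

text \<open>In \<open>searched\<close>, the set \<open>D\<close> holds the quadruples seen so far,
  and the record is a move at least as good as every move in \<open>D\<close>. One more quadruple
  either replaces the record or confirms it. The cell \<open>i\<close> is carried along for the loop
  over rounds.\<close>

lemma achieves_examine:
  assumes J: "searched k L \<sigma> D s" and cells: "fst s ''p'' 0 = p" "fst s ''r'' 0 = r"
    "fst s ''v'' 0 = v" "fst s ''u'' 0 = u" and less: "p < n" "r < n" "v < n" "u < n"
  shows "achieves w N examine s (\<lambda>s'. searched k L \<sigma> (D \<union> {(p, r, v, u)}) s' \<and>
    fst s' ''p'' 0 = p \<and> fst s' ''r'' 0 = r \<and> fst s' ''v'' 0 = v \<and> fst s' ''u'' 0 = u)"
    (is "achieves w N examine s ?Q")
  unfolding examine_def
proof (rule achieves_Cond)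
  have seat: "seating L \<sigma> s" and kept: "input_kept s" and size: "fst s ''n'' 0 = n"
    and i: "fst s ''i'' 0 = k"
    using J by (auto simp: searched_def seating_def input_kept_def)
  note adm = bval_admissible[OF seat cells less]
  \<comment> \<open>The equivalence is claimed only for moves: their agents are distinct and in
    range, so \<open>val_cell\<close> applies.\<close>
  have imp: "bval improving s \<longleftrightarrow> fst s ''found'' 0 = 0 \<or>
      g (fst s ''bp'' 0) (fst s ''br'' 0) < g p r" if "move L \<sigma> p r v u"
  proof (cases "fst s ''found'' 0 = 0")
    case True
    then show ?thesis by (simp add: improving_def bval_BOr bval_NEq)
  next
    case False
    then have "move L \<sigma> (fst s ''bp'' 0) (fst s ''br'' 0) (fst s ''bv'' 0) (fst s ''bu'' 0)"
      using J by (simp add: searched_def)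
    with False that show ?thesis
      by (auto simp: improving_def bval_BOr bval_NEq cell_def size cells val_cell[OF kept]
          dest!: move_less)
  qed
  show "comparison_only (BAnd admissible improving)"
    by (simp add: admissible_def improving_def comparison_only_NEq comparison_only_BOr)
  show "achieves w N record_move s ?Q" if "bval (BAnd admissible improving) s"
  proof -
    have mv: "move L \<sigma> p r v u" using that adm by simp
    with that imp have new: "fst s ''found'' 0 = 0 \<or> g (fst s ''bp'' 0) (fst s ''br'' 0) < g p r"
      by simp
    \<comment> \<open>The new record strictly beats the old one, which dominated \<open>D\<close>;
      without an old record \<open>D\<close> contains no move.\<close>
    have "g p' r' \<le> g p r" if "(p', r', v', u') \<in> D" "move L \<sigma> p' r' v' u'" for p' r' v' u'
    proof (cases "fst s ''found'' 0 = 0")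
      case True
      with J that show ?thesis by (auto simp: searched_def)
    next
      case False
      with J that have "g p' r' \<le> g (fst s ''bp'' 0) (fst s ''br'' 0)" by (auto simp: searched_def)
      with new False show ?thesis by auto
    qed
    then have best: "\<forall>(p', r', v', u')\<in>D. move L \<sigma> p' r' v' u' \<longrightarrow> g p' r' \<le> g p r" by blast
    show ?thesis
      unfolding record_move_def
      using seat i mv best cells less n_le N_pos
      by (intro achieves_Seq achieves_NWrite)
        (simp_all add: nwrite_simps searched_def seating_def input_kept_def)
  qed
  show "achieves w N Skip s ?Q" if "\<not> bval (BAnd admissible improving) s"
  proof -
    have old: "\<not> move L \<sigma> p r v u \<or>
        fst s ''found'' 0 \<noteq> 0 \<and> g p r \<le> g (fst s ''bp'' 0) (fst s ''br'' 0)"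
      using that adm imp by (auto simp: not_less)
    have "searched k L \<sigma> (D \<union> {(p, r, v, u)}) s"
    proof (cases "fst s ''found'' 0 = 0")
      case True
      with J old show ?thesis by (simp add: searched_def)
    next
      case False
      with J old show ?thesis by (simp add: searched_def)
    qed
    with cells show ?thesis by (intro achieves_Skip) simp
  qed
qed

text \<open>Four uses of \<open>achieves_For_Union\<close> from the inside out: each level enlarges
  \<open>D\<close> by slices of the product while the enclosing counters stay fixed.\<close>

lemma achieves_search:
  assumes "searched k L \<sigma> {} s"
  shows "achieves w N search s (searched k L \<sigma> ({..<n} \<times> {..<n} \<times> {..<n} \<times> {..<n}))"
proof -
  have stable: "searched k L \<sigma> D (nwrite x 0 m s) \<longleftrightarrow> searched k L \<sigma> D s"
    if "x \<in> {''p'', ''r'', ''v'', ''u''}" for x m D s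
    using that
    by (elim insertE emptyE) (simp_all add: nwrite_simps searched_def seating_def input_kept_def)
  have size: "searched k L \<sigma> D s \<Longrightarrow> fst s ''n'' 0 = n" for D s
    unfolding searched_def by (blast intro: seating_size)
  have u: "achieves w N (For ''u'' examine) s (\<lambda>s'. searched k L \<sigma> (D \<union> {p} \<times> {r} \<times> {v} \<times> {..<n}) s' \<and>
      fst s' ''p'' 0 = p \<and> fst s' ''r'' 0 = r \<and> fst s' ''v'' 0 = v)"
    if "searched k L \<sigma> D s" "fst s ''p'' 0 = p" "fst s ''r'' 0 = r" "fst s ''v'' 0 = v"
      "p < n" "r < n" "v < n" for D s p r v
  proof -
    let ?J = "\<lambda>D s. searched k L \<sigma> D s \<and> fst s ''p'' 0 = p \<and> fst s ''r'' 0 = r \<and> fst s ''v'' 0 = v"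
    have "achieves w N (For ''u'' examine) s (?J (D \<union> (\<Union>u<n. {(p, r, v, u)})))"
    proof (rule achieves_For_Union[where J = ?J])
      fix u D s assume "u < n" "?J D s" "fst s ''u'' 0 = u"
      then show "achieves w N examine s (\<lambda>s'. ?J (D \<union> {(p, r, v, u)}) s' \<and> fst s' ''u'' 0 = u)"
        using that(5-7) by (intro achieves_conseq[OF achieves_examine[of k L \<sigma> D s p r v u]]) auto
    next
      show "fst s ''n'' 0 = n" if "?J D s" for D s using that size by blast
    qed (use that n_le in \<open>simp_all add: stable nwrite_simps\<close>)
    moreover have "(\<Union>u<n. {(p, r, v, u)}) = {p} \<times> {r} \<times> {v} \<times> {..<n}" by auto
    ultimately show ?thesis by simp
  qed
  have v: "achieves w N (For ''v'' (For ''u'' examine)) s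
      (\<lambda>s'. searched k L \<sigma> (D \<union> {p} \<times> {r} \<times> {..<n} \<times> {..<n}) s' \<and>
        fst s' ''p'' 0 = p \<and> fst s' ''r'' 0 = r)"
    if "searched k L \<sigma> D s" "fst s ''p'' 0 = p" "fst s ''r'' 0 = r" "p < n" "r < n" for D s p r
  proof -
    let ?J = "\<lambda>D s. searched k L \<sigma> D s \<and> fst s ''p'' 0 = p \<and> fst s ''r'' 0 = r"
    have "achieves w N (For ''v'' (For ''u'' examine)) s
        (?J (D \<union> (\<Union>v<n. {p} \<times> {r} \<times> {v} \<times> {..<n})))"
    proof (rule achieves_For_Union[where J = ?J])
      fix v D s assume "v < n" "?J D s" "fst s ''v'' 0 = v"
      then show "achieves w N (For ''u'' examine) s
          (\<lambda>s'. ?J (D \<union> {p} \<times> {r} \<times> {v} \<times> {..<n}) s' \<and> fst s' ''v'' 0 = v)"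
        using that(4-5) by (intro achieves_conseq[OF u[of D s p r v]]) auto
    next
      show "fst s ''n'' 0 = n" if "?J D s" for D s using that size by blast
    qed (use that n_le in \<open>simp_all add: stable nwrite_simps\<close>)
    moreover have "(\<Union>v<n. {p} \<times> {r} \<times> {v} \<times> {..<n}) = {p} \<times> {r} \<times> {..<n} \<times> {..<n}" by auto
    ultimately show ?thesis by simp
  qed
  have r: "achieves w N (For ''r'' (For ''v'' (For ''u'' examine))) s
      (\<lambda>s'. searched k L \<sigma> (D \<union> {p} \<times> {..<n} \<times> {..<n} \<times> {..<n}) s' \<and> fst s' ''p'' 0 = p)"
    if "searched k L \<sigma> D s" "fst s ''p'' 0 = p" "p < n" for D s p
  proof -
    let ?J = "\<lambda>D s. searched k L \<sigma> D s \<and> fst s ''p'' 0 = p"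
    have "achieves w N (For ''r'' (For ''v'' (For ''u'' examine))) s
        (?J (D \<union> (\<Union>r<n. {p} \<times> {r} \<times> {..<n} \<times> {..<n})))"
    proof (rule achieves_For_Union[where J = ?J])
      fix r D s assume "r < n" "?J D s" "fst s ''r'' 0 = r"
      then show "achieves w N (For ''v'' (For ''u'' examine)) s
          (\<lambda>s'. ?J (D \<union> {p} \<times> {r} \<times> {..<n} \<times> {..<n}) s' \<and> fst s' ''r'' 0 = r)"
        using that(3) by (intro achieves_conseq[OF v[of D s p r]]) auto
    next
      show "fst s ''n'' 0 = n" if "?J D s" for D s using that size by blast
    qed (use that n_le in \<open>simp_all add: stable nwrite_simps\<close>)
    moreover have "(\<Union>r<n. {p} \<times> {r} \<times> {..<n} \<times> {..<n}) = {p} \<times> {..<n} \<times> {..<n} \<times> {..<n}" by auto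
    ultimately show ?thesis by simp
  qed
  have "achieves w N search s (searched k L \<sigma> ({} \<union> (\<Union>p<n. {p} \<times> {..<n} \<times> {..<n} \<times> {..<n})))"
    unfolding search_def
  proof (rule achieves_For_Union[where J = "searched k L \<sigma>"])
    fix p D s assume "p < n" "searched k L \<sigma> D s" "fst s ''p'' 0 = p"
    then show "achieves w N (For ''r'' (For ''v'' (For ''u'' examine))) s
        (\<lambda>s'. searched k L \<sigma> (D \<union> {p} \<times> {..<n} \<times> {..<n} \<times> {..<n}) s' \<and> fst s' ''p'' 0 = p)"
      using r by simp
  next
    show "fst s ''n'' 0 = n" if "searched k L \<sigma> D s" for D s using that size by blast
  qed (use assms n_le in \<open>simp_all add: stable\<close>)
  moreover have "(\<Union>p<n. {p} \<times> {..<n} \<times> {..<n} \<times> {..<n}) = {..<n} \<times> {..<n} \<times> {..<n} \<times> {..<n}" by auto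
  ultimately show ?thesis by simp
qed

section \<open>Placing agents and greedy rounds\<close>

lemma achieves_place:
  assumes "x \<notin> {''seat'', ''placed'', ''taken''}" "y \<notin> {''seat'', ''placed'', ''taken''}"
    and "fst s x 0 = a" "fst s y 0 = b" "b \<le> N"
    and "Q (nwrite ''taken'' b 1 (nwrite ''placed'' a 1 (nwrite ''seat'' a b s)))"
  shows "achieves w N (place (NVar x) (NVar y)) s Q"
  unfolding place_def using assms N_pos
  by (intro achieves_Seq achieves_NWrite) (simp_all add: nwrite_simps)

text \<open>The second alternative puts a seated agent on its own seat again. Under either one no
  occupied seat is vacated, so the \<open>taken\<close> flags stay correct.\<close>

lemma seating_place:
  assumes "seating L \<sigma> s" and "a \<notin> L \<or> \<sigma> a = b"
  shows "seating (insert a L) (\<sigma>(a := b))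
    (nwrite ''taken'' b 1 (nwrite ''placed'' a 1 (nwrite ''seat'' a b s)))"
proof -
  have "(\<sigma>(a := b)) ` insert a L = insert b (\<sigma> ` L)"
    using assms(2) by (auto simp: image_iff)
  with assms(1) show ?thesis
    unfolding seating_def by (auto simp: nwrite_simps input_kept_def)
qed

text \<open>The last disjunction measures progress: at \<open>i = n\<close> either everybody is
  seated or no move is left.\<close>

definition rounds_done :: "nat \<Rightarrow> 'a memory \<Rightarrow> bool" where
  "rounds_done i s \<longleftrightarrow> (\<exists>L \<sigma>. seating L \<sigma> s \<and> partial_arrangement L \<sigma> \<and> unblocked L L \<sigma> \<and>
    (i \<le> card L \<or> (\<nexists>p r v u. move L \<sigma> p r v u)))"

lemma achieves_round:
  assumes "rounds_done i s" "fst s ''i'' 0 = k"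
  shows "achieves w N greedy_round s (\<lambda>s'. rounds_done (Suc i) s' \<and> fst s' ''i'' 0 = k)"
proof -
  from assms(1) obtain L \<sigma> where seat: "seating L \<sigma> s" and part: "partial_arrangement L \<sigma>"
    and unbl: "unblocked L L \<sigma>" and prog: "i \<le> card L \<or> (\<nexists>p r v u. move L \<sigma> p r v u)"
    unfolding rounds_done_def by blast
  have "searched k L \<sigma> {} (nwrite ''found'' 0 0 s)"
    using seat assms(2) by (simp add: searched_def seating_def input_kept_def nwrite_simps)
  note search = achieves_search[OF this]
  have finish: "achieves w N (Cond (NLess (NConst 0) (NVar ''found''))
       (Seq (place (NVar ''bp'') (NVar ''bv'')) (place (NVar ''br'') (NVar ''bu''))) Skip) s'
       (\<lambda>s'. rounds_done (Suc i) s' \<and> fst s' ''i'' 0 = k)"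
    if J: "searched k L \<sigma> ({..<n} \<times> {..<n} \<times> {..<n} \<times> {..<n}) s'" for s'
  proof (rule achieves_Cond)
    assume found: "bval (NLess (NConst 0) (NVar ''found'')) s'"
    define p r v u where "p = fst s' ''bp'' 0" and "r = fst s' ''br'' 0"
      and "v = fst s' ''bv'' 0" and "u = fst s' ''bu'' 0"
    note vars = p_def[symmetric] r_def[symmetric] v_def[symmetric] u_def[symmetric]
    have mv: "move L \<sigma> p r v u" and seat': "seating L \<sigma> s'" and k: "fst s' ''i'' 0 = k"
      using J found by (auto simp: searched_def vars)
    have best: "\<phi> (g p' r') \<le> \<phi> (g p r)" if "move L \<sigma> p' r' v' u'" for p' r' v' u'
    proof -
      have "(p', r', v', u') \<in> {..<n} \<times> {..<n} \<times> {..<n} \<times> {..<n}"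
        using move_less[OF that] by simp
      with J found that show ?thesis by (auto simp: searched_def vars mono_le)
    qed
    define L' where "L' = insert p (insert r L)"
    define \<sigma>' where "\<sigma>' = \<sigma>(p := v, r := u)"
    have unbl': "unblocked L' L' \<sigma>'"
      unfolding L'_def \<sigma>'_def using unblocked_move[OF part unbl mv] best by blast
    have part': "partial_arrangement L' \<sigma>'"
      unfolding L'_def \<sigma>'_def by (rule partial_move[OF part mv])
    have "L \<subseteq> {..<n}" using part by (simp add: partial_arrangement_def)
    then have "finite L" using finite_subset by blast
    moreover have "p \<notin> L" "p \<noteq> r" using mv by (auto simp: move_def)
    \<comment> \<open>The agent \<open>p\<close> was unseated, so at least one agent is gained;
      \<open>r\<close> may be a second one.\<close>
    ultimately have "Suc (card L) \<le> card L'"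
      by (simp add: L'_def card_insert_if)
    with prog mv have card': "Suc i \<le> card L'" by auto
    let ?s1 = "nwrite ''taken'' v 1 (nwrite ''placed'' p 1 (nwrite ''seat'' p v s'))"
    let ?s2 = "nwrite ''taken'' u 1 (nwrite ''placed'' r 1 (nwrite ''seat'' r u ?s1))"
    have "seating (insert p L) (\<sigma>(p := v)) ?s1"
      using mv by (intro seating_place[OF seat']) (simp add: move_def)
    \<comment> \<open>A seated \<open>r\<close> already occupies \<open>u\<close>, so the second
      placement is harmless.\<close>
    moreover have "r \<notin> insert p L \<or> (\<sigma>(p := v)) r = u"
      using mv by (auto simp: move_def split: if_splits)
    ultimately have "seating (insert r (insert p L)) ((\<sigma>(p := v))(r := u)) ?s2"
      by (rule seating_place)
    then have "seating L' \<sigma>' ?s2" by (simp add: L'_def \<sigma>'_def insert_commute)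
    with unbl' part' card' have "rounds_done (Suc i) ?s2"
      unfolding rounds_done_def by blast
    moreover have "fst ?s2 ''i'' 0 = k" using k by (simp add: nwrite_simps)
    moreover have "v \<le> N" "u \<le> N" using move_less[OF mv] n_le by auto
    ultimately show "achieves w N (Seq (place (NVar ''bp'') (NVar ''bv''))
        (place (NVar ''br'') (NVar ''bu''))) s'
        (\<lambda>s'. rounds_done (Suc i) s' \<and> fst s' ''i'' 0 = k)"
      by (intro achieves_Seq achieves_place[where a = p and b = v] achieves_place[where a = r and b = u])
        (simp_all add: nwrite_simps vars)
  next
    assume "\<not> bval (NLess (NConst 0) (NVar ''found'')) s'"
    \<comment> \<open>The search covered all quadruples below \<open>n\<close>, so the second
      alternative of \<open>rounds_done\<close> holds.\<close>
    then have "\<not> move L \<sigma> p r v u" for p r v u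
      using J move_less[of L \<sigma> p r v u] by (auto simp: searched_def)
    moreover have "seating L \<sigma> s'" "fst s' ''i'' 0 = k"
      using J by (simp_all add: searched_def)
    ultimately show "achieves w N Skip s' (\<lambda>s'. rounds_done (Suc i) s' \<and> fst s' ''i'' 0 = k)"
      using part unbl unfolding rounds_done_def by (intro achieves_Skip) blast
  qed simp
  show ?thesis
    unfolding greedy_round_def
    by (intro achieves_Seq achieves_NWrite achieves_conseq[OF search])
      (simp_all add: search finish achieves_conseq[OF search])
qed

section \<open>Filling the remaining seats\<close>

definition settled :: "nat set \<Rightarrow> 'a memory \<Rightarrow> bool" where
  "settled L s \<longleftrightarrow> seating L (fst s ''seat'') s \<and> partial_arrangement L (fst s ''seat'') \<and>
    unblocked {..<n} L (fst s ''seat'')"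

text \<open>Either \<open>n \<le> card L\<close> forces \<open>L\<close> to contain everybody, or
  \<open>unblocked_no_move\<close> applies; both ways all agents are safe from blocking.\<close>

lemma rounds_done_settled:
  assumes "rounds_done n s"
  shows "\<exists>L. settled L s"
proof -
  from assms obtain L \<sigma> where seat: "seating L \<sigma> s" and part: "partial_arrangement L \<sigma>"
    and unbl: "unblocked L L \<sigma>" and prog: "n \<le> card L \<or> (\<nexists>p r v u. move L \<sigma> p r v u)"
    unfolding rounds_done_def by blast
  have "L = {..<n}" if "n \<le> card L"
    using that part by (intro card_seteq) (auto simp: partial_arrangement_def)
  then have "unblocked {..<n} L \<sigma>"
    using prog unbl unblocked_no_move[OF part unbl] by auto
  with seat part show ?thesis unfolding settled_def by (auto simp: seating_def)
qed

lemma settled_nwrite: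
  "x \<in> {''i'', ''p'', ''v''} \<Longrightarrow> settled L (nwrite x 0 k s) \<longleftrightarrow> settled L s"
  by (elim insertE emptyE)
    (simp_all add: settled_def seating_def input_kept_def nwrite_simps)

lemma rounds_done_nwrite: "rounds_done i s \<Longrightarrow> rounds_done i (nwrite ''i'' 0 k s)"
  by (simp add: rounds_done_def seating_def input_kept_def nwrite_simps)

text \<open>When nothing is written, \<open>p\<close> is seated or \<open>v\<close> is taken; the
  loop over \<open>v\<close> uses this to see that \<open>p\<close> ends up seated.\<close>

lemma achieves_fill_seat:
  assumes st: "settled L s" and p: "fst s ''p'' 0 = p" "p < n" and v: "fst s ''v'' 0 = v" "v < n"
  shows "achieves w N fill_seat s (\<lambda>s'. fst s' ''p'' 0 = p \<and> fst s' ''v'' 0 = v \<and>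
    (s' = s \<and> (p \<in> L \<or> v \<in> fst s ''seat'' ` L) \<or> settled (insert p L) s'))"
    (is "achieves w N fill_seat s ?Q")
  unfolding fill_seat_def
proof (rule achieves_Cond)
  let ?\<sigma> = "fst s ''seat''"
  have seat: "seating L ?\<sigma> s" and part: "partial_arrangement L ?\<sigma>"
    and unbl: "unblocked {..<n} L ?\<sigma>"
    using st by (simp_all add: settled_def)
  have free: "fst s ''placed'' p = 0 \<longleftrightarrow> p \<notin> L" "fst s ''taken'' v = 0 \<longleftrightarrow> v \<notin> ?\<sigma> ` L"
    using seat p(2) v(2) by (simp_all add: seating_def)
  {
    assume "bval (BAnd (NEq (NRead ''placed'' (NVar ''p'')) (NConst 0))
       (NEq (NRead ''taken'' (NVar ''v'')) (NConst 0))) s"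
    then have new: "p \<in> {..<n} - L" "v \<in> {..<n} - ?\<sigma> ` L"
      using p v free by (simp_all add: bval_NEq)
    let ?s = "nwrite ''taken'' v 1 (nwrite ''placed'' p 1 (nwrite ''seat'' p v s))"
    have "seating (insert p L) (?\<sigma>(p := v)) ?s"
      using new by (intro seating_place[OF seat]) simp
    moreover have "partial_arrangement (insert p L) (?\<sigma>(p := v))"
      by (rule partial_insert[OF part new])
    moreover have "unblocked {..<n} (insert p L) (?\<sigma>(p := v))"
      using new by (intro unblocked_extend[OF unbl]) auto
    ultimately have "settled (insert p L) ?s"
      unfolding settled_def by (simp only: nwrite_simps) simp
    moreover have "fst ?s ''p'' 0 = p" "fst ?s ''v'' 0 = v"
      using p v by (simp_all add: nwrite_simps)
    ultimately have "?Q ?s" by blast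
    then show "achieves w N (place (NVar ''p'') (NVar ''v'')) s ?Q"
      using p v n_le by (intro achieves_place[where a = p and b = v]) simp_all
  next
    assume "\<not> bval (BAnd (NEq (NRead ''placed'' (NVar ''p'')) (NConst 0))
       (NEq (NRead ''taken'' (NVar ''v'')) (NConst 0))) s"
    then have "p \<in> L \<or> v \<in> ?\<sigma> ` L"
      using p v free by (simp add: bval_NEq)
    with p v have "?Q s" by blast
    then show "achieves w N Skip s ?Q" by (rule achieves_Skip)
  }
qed (simp add: comparison_only_NEq)

lemma achieves_fill:
  assumes "settled L s"
  shows "achieves w N (For ''p'' (For ''v'' fill_seat)) s (settled {..<n})"
proof -
  have size: "settled L s \<Longrightarrow> fst s ''n'' 0 = n" for L s
    unfolding settled_def by (blast intro: seating_size)
  have sub: "settled L s \<Longrightarrow> L \<subseteq> {..<n}" for L s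
    by (simp add: settled_def partial_arrangement_def)
  let ?K = "\<lambda>p s. \<exists>L. settled L s \<and> {..<p} \<subseteq> L"
  have row: "achieves w N (For ''v'' fill_seat) s (\<lambda>s'. ?K (Suc p) s' \<and> fst s' ''p'' 0 = p)"
    if K: "?K p s" and p: "fst s ''p'' 0 = p" "p < n" for p s
  proof -
    \<comment> \<open>As long as \<open>p\<close> is unseated, every seat tried so far is occupied;
      at \<open>j = n\<close> this contradicts \<open>partial_free_seat\<close>.\<close>
    let ?I = "\<lambda>j s. \<exists>L. settled L s \<and> {..<p} \<subseteq> L \<and> (p \<in> L \<or> {..<j} \<subseteq> fst s ''seat'' ` L) \<and>
      fst s ''p'' 0 = p"
    have "achieves w N (For ''v'' fill_seat) s (?I n)"
    proof (rule achieves_For[where I = ?I])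
      fix j s assume j: "j < n" "fst s ''v'' 0 = j" and "?I j s"
      then obtain L where L: "settled L s" "{..<p} \<subseteq> L" "p \<in> L \<or> {..<j} \<subseteq> fst s ''seat'' ` L"
        "fst s ''p'' 0 = p" by blast
      from achieves_fill_seat[OF L(1) L(4) p(2) j(2,1)]
      show "achieves w N fill_seat s (\<lambda>s'. ?I (Suc j) s' \<and> fst s' ''v'' 0 = j)"
      proof (rule achieves_conseq)
        fix s' assume s': "fst s' ''p'' 0 = p \<and> fst s' ''v'' 0 = j \<and>
          (s' = s \<and> (p \<in> L \<or> j \<in> fst s ''seat'' ` L) \<or> settled (insert p L) s')"
        show "?I (Suc j) s' \<and> fst s' ''v'' 0 = j"
        proof (cases "settled (insert p L) s'")
          case True
          with s' L(2) show ?thesis by (intro conjI exI[of _ "insert p L"]) auto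
        next
          case False
          with s' L show ?thesis by (intro conjI exI[of _ L]) (auto simp: lessThan_Suc)
        qed
      qed
    next
      show "?I 0 s" using K p by auto
      show "fst s ''n'' 0 = n" if "?I j s" for j s using that size by blast
      show "?I j (nwrite ''v'' 0 k s)" if "?I j s" for j s k
        using that by (simp add: settled_nwrite nwrite_simps)
    qed (use n_le in simp_all)
    then show ?thesis
    proof (rule achieves_conseq)
      fix s' assume "?I n s'"
      then obtain L where L: "settled L s'" "{..<p} \<subseteq> L" "p \<in> L \<or> {..<n} \<subseteq> fst s' ''seat'' ` L"
        "fst s' ''p'' 0 = p" by blast
      have "p \<in> L"
      proof (rule ccontr)
        assume "p \<notin> L"
        with p L(1) obtain v where "v < n" "v \<notin> fst s' ''seat'' ` L"
          using partial_free_seat[of L "fst s' ''seat''" p] by (auto simp: settled_def)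
        with L(3) \<open>p \<notin> L\<close> show False by auto
      qed
      with L show "?K (Suc p) s' \<and> fst s' ''p'' 0 = p" by (auto simp: lessThan_Suc)
    qed
  qed
  have "achieves w N (For ''p'' (For ''v'' fill_seat)) s (?K n)"
  proof (rule achieves_For[where I = ?K])
    show "achieves w N (For ''v'' fill_seat) s (\<lambda>s'. ?K (Suc p) s' \<and> fst s' ''p'' 0 = p)"
      if "p < n" "?K p s" "fst s ''p'' 0 = p" for p s
      by (rule row[OF that(2,3,1)])
    show "?K 0 s" using assms by auto
    show "fst s ''n'' 0 = n" if "?K p s" for p s using that size by blast
    show "?K p (nwrite ''p'' 0 k s)" if "?K p s" for p s k
      using that by (simp add: settled_nwrite)
  qed (use n_le in simp_all)
  then show ?thesis
    by (rule achieves_conseq) (metis sub subset_antisym)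
qed

lemma greedy_program_correct:
  assumes "bounded_memory w N (input_memory n E g)"
  shows "\<exists>t s'. exec w greedy_program (input_memory n E g) t s' \<and>
    t \<le> com_cost_bound N greedy_program \<and> arrangement {..<n} {..<n} (fst s' ''seat'') \<and>
    exchange_stable {..<n} E (\<lambda>i j. \<phi> (g i j)) (fst s' ''seat'')"
proof -
  \<comment> \<open>All flags start at 0, which represents the empty seating.\<close>
  have "seating {} (fst (input_memory n E g) ''seat'') (input_memory n E g)"
    by (simp add: seating_def input_kept_def input_memory_def)
  then have "rounds_done 0 (input_memory n E g)"
    unfolding rounds_done_def
    by (intro exI conjI) (auto simp: partial_arrangement_def unblocked_def)
  then have "achieves w N (For ''i'' greedy_round) (input_memory n E g) (rounds_done n)"
  proof (rule achieves_For[where I = rounds_done, rotated -1])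
    show "achieves w N greedy_round s (\<lambda>s'. rounds_done (Suc i) s' \<and> fst s' ''i'' 0 = i)"
      if "rounds_done i s" "fst s ''i'' 0 = i" for i s
      by (rule achieves_round[OF that])
    show "fst s ''n'' 0 = n" if "rounds_done i s" for i s
      using that unfolding rounds_done_def by (blast intro: seating_size)
  qed (use n_le rounds_done_nwrite in simp_all)
  moreover have "achieves w N (For ''p'' (For ''v'' fill_seat)) s (settled {..<n})"
    if "rounds_done n s" for s
    using rounds_done_settled[OF that] achieves_fill by blast
  ultimately have "achieves w N greedy_program (input_memory n E g) (settled {..<n})"
    unfolding greedy_program_def by (intro achieves_Seq) (rule achieves_conseq)
  with assms obtain t s' where "exec w greedy_program (input_memory n E g) t s'"
    "t \<le> com_cost_bound N greedy_program" and st: "settled {..<n} s'"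
    unfolding achieves_def by blast
  then show ?thesis
    using partial_complete[of "fst s' ''seat''"] unblocked_stable[of "fst s' ''seat''"]
    unfolding settled_def by blast
qed

end

section \<open>Input size and polynomial running time\<close>

lemma le_input_size: "n \<le> input_size w n g"
  unfolding input_size_def by (intro trans_le_add1 trans_le_add2 le_square)

text \<open>The summand \<open>w 0\<close> covers field cells without input, and 1 covers the
  adjacency entries.\<close>

lemma bounded_input_memory:
  "bounded_memory w (input_size w n g + w 0 + 1) (input_memory n E g)"
proof -
  have weight: "w (g i j) \<le> input_size w n g" if "i < n" "j < n" "i \<noteq> j" for i j
  proof -
    have "w (g i j) \<le> (\<Sum>j\<in>{..<n} - {i}. w (g i j))"
      using that by (intro member_le_sum) auto
    also have "\<dots> \<le> (\<Sum>i<n. \<Sum>j\<in>{..<n} - {i}. w (g i j))"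
      using that by (intro member_le_sum[of i "{..<n}" "\<lambda>i. \<Sum>j\<in>{..<n} - {i}. w (g i j)"]) auto
    also have "\<dots> \<le> input_size w n g"
      unfolding input_size_def by (rule le_add2)
    finally show ?thesis .
  qed
  have "w (snd (input_memory n E g) x k) \<le> input_size w n g + w 0 + 1" for x k
  proof (cases "x = ''val'' \<and> k < n * n \<and> k div n \<noteq> k mod n")
    case True
    then have "0 < n" by (cases n) auto
    with True have "k div n < n" "k mod n < n"
      by (simp_all add: less_mult_imp_div_less)
    with True have "w (g (k div n) (k mod n)) \<le> input_size w n g"
      by (intro weight) auto
    with True show ?thesis by (simp add: input_memory_def)
  next
    case False
    then have "snd (input_memory n E g) x k = 0" by (auto simp: input_memory_def)
    then show ?thesis by simp
  qed
  moreover have "fst (input_memory n E g) x k \<le> input_size w n g + w 0 + 1" for x k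
    using le_input_size[of n w g] by (simp add: input_memory_def)
  ultimately show ?thesis by (simp add: bounded_memory_def)
qed

text \<open>Field elements are only compared and never created, so their weights stay those of the
  input, and one argument serves every cost model.\<close>

lemma greedy_program_poly_time:
  fixes w :: "'a::linordered_field \<Rightarrow> nat"
  assumes mono: "\<And>x y. \<phi> x < \<phi> y \<longleftrightarrow> x < y"
  shows "computes_stable_in_poly_time w \<phi> greedy_program"
proof -
  obtain q where q: "com_cost_bound N greedy_program = poly q N" for N
    using polynomial_com_cost_bound[of greedy_program] unfolding polynomial_fun_def by blast
  \<comment> \<open>Substituting \<open>x + w 0 + 1\<close> turns the bound in \<open>N\<close> into
    one in the input size.\<close>
  define q' where "q' = pcompose q [:w 0 + 1, 1:]"
  have q': "poly q' m = com_cost_bound (m + w 0 + 1) greedy_program" for m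
    by (simp add: q q'_def poly_pcompose algebra_simps)
  show ?thesis
    unfolding computes_stable_in_poly_time_def
  proof (intro exI[of _ q'] allI impI)
    fix n E and g :: "nat \<Rightarrow> nat \<Rightarrow> 'a"
    assume inst: "sa_instance {..<n} {..<n} E"
      and symm: "symmetric_preferences {..<n} (\<lambda>i j. \<phi> (g i j))"
    have "n \<le> input_size w n g + w 0 + 1"
      using le_input_size[of n w g] by simp
    then interpret greedy_run n E g w \<phi> "input_size w n g + w 0 + 1"
      using inst symm mono by unfold_locales auto
    from greedy_program_correct[OF bounded_input_memory]
    show "\<exists>t s'. exec w greedy_program (input_memory n E g) t s' \<and> t \<le> poly q' (input_size w n g) \<and>
        arrangement {..<n} {..<n} (fst s' ''seat'') \<and>
        exchange_stable {..<n} E (\<lambda>i j. \<phi> (g i j)) (fst s' ''seat'')"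
      by (simp only: q')
  qed
qed

theorem theorem2:
  "(\<forall>(P :: 'p set) (V :: 'v set) E (f :: 'p \<Rightarrow> 'p \<Rightarrow> real).
      sa_instance P V E \<longrightarrow> symmetric_preferences P f \<longrightarrow>
      (\<exists>\<sigma>. arrangement P V \<sigma> \<and> exchange_stable P E f \<sigma>)) \<and>
   (\<exists>c. computes_stable_in_poly_time (\<lambda>x :: real. 1) (\<lambda>x. x) c \<and>
        computes_stable_in_poly_time rat_bits real_of_rat c)"
proof (intro conjI allI impI exI[of _ greedy_program])
  fix P :: "'p set" and V :: "'v set" and E and f :: "'p \<Rightarrow> 'p \<Rightarrow> real"
  assume "sa_instance P V E" "symmetric_preferences P f"
  then interpret symmetric_seat_arrangement P V E f by unfold_locales
  show "\<exists>\<sigma>. arrangement P V \<sigma> \<and> exchange_stable P E f \<sigma>" by (rule exchange_stable_exists)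
\<comment> \<open>The remaining goals are the two cost models; the identity and
  \<open>of_rat\<close> both preserve and reflect the order.\<close>
qed (intro greedy_program_poly_time; simp add: of_rat_less)+

end
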